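(* Let $\mathcal{R}(\mathbb{X},f)$ be the Reeb graph of the constructible $\mathbb{R}$-space $(\mathbb{X},f)$ and let $\mathcal{D}(\hat{\mathscr{D}}^\pi_n)$ be the display locale of the random cosheaf $\hat{\mathscr{D}}^\pi_n$ (the enhanced mapper graph of the sample). If there exists $\epsilon<\delta_\mathcal{U}$ such that $p$ is $\epsilon$-concentrated on $\mathbb{X}$, then $$\lim_{n\to\infty}\mathbb{P}\left(d_R\big(\mathcal{D}(\hat{\mathscr{D}}^\pi_n),\mathcal{R}(\mathbb{X},f)\big)\le\operatorname{res}_f\mathcal{U}\right)=1 .$$
   Context: $\mathbb{R}$-spaces and Reeb distance. An $\mathbb{R}$-space is a pair $(\mathbb{Y},g)$ with $g:\mathbb{Y}\to\mathbb{R}$ continuous; morphisms are continuous maps commuting with the functions to $\mathbb{R}$. It is constructible if there are $a_0<\dots<a_m$ in $\mathbb{R}$, locally path-connected spaces $\mathbb{V}_0,\dots,\mathbb{V}_m$, $\mathbb{E}_0,\dots,\mathbb{E}_{m-1}$ and continuous maps $\ell_i:\mathbb{E}_i\to\mathbb{V}_i$, $r_i:\mathbb{E}_i\to\mathbb{V}_{i+1}$ such that $\mathbb{Y}$ is the quotient of $\coprod_i\mathbb{V}_i\times\{a_i\}\sqcup\coprod_i\mathbb{E}_i\times[a_i,a_{i+1}]$ by $(\ell_i(x),a_i)\sim(x,a_i)$, $(r_i(x),a_{i+1})\sim(x,a_{i+1})$, with $g$ the projection to the second factor; it is an $\mathbb{R}$-graph if all $\mathbb{V}_i,\mathbb{E}_i$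 are finite discrete sets. The Reeb graph $\mathcal{R}(\mathbb{Y},g)$ is the quotient of $\mathbb{Y}$ identifying points lying in the same connected component of a level set $g^{-1}(a)$, with the induced function; $\mathcal{R}$ is functorial. The thickening is $\mathcal{T}_\varepsilon(\mathbb{Y},g)=(\mathbb{Y}\times[-\varepsilon,\varepsilon],\,(y,t)\mapsto g(y)+t)$, functorial via $\alpha\mapsto\alpha\times\mathrm{id}$. The smoothing of an $\mathbb{R}$-graph is $\mathcal{S}_\varepsilon=\mathcal{R}\circ\mathcal{T}_\varepsilon$, and $\zeta^\varepsilon_{\mathbb{F}}:(\mathbb{F},g)\to\mathcal{S}_\varepsilon(\mathbb{F},g)$ is $y\mapsto(y,0)$ followed by the Reeb quotient map. $\mathbb{R}$-graphs $\mathbb{F},\mathbb{G}$ are $\varepsilon$-interleaved if there are morphisms $\alpha:\mathbb{F}\to\mathcal{S}_\varepsilon(\mathbb{G})$, $\beta:\mathbb{G}\to\mathcal{S}_\varepsilon(\mathbb{F})$ with $\mathcal{S}_\varepsilon(\beta)\circ\alpha=\zeta^\varepsilon_{\mathcal{S}_\varepsilon(\mathbb{F})}\circ\zeta^\varepsilon_\mathbb{F}$ and $\mathcal{S}_\varepsilon(\alpha)\circ\beta=\zeta^\varepsilon_{\mathcal{S}_\varepsilon(\mathbb{G})}\circ\zeta^\varepsilon_\mathbb{G}$. The Reeb (interleaving) distance $d_R$ is the infimum of all $\varepsilon$ for which the two are $\varepsilon$-interleaved. Cosheaves and display locale. $\mathbf{Int}$ is the category of (nonempty) connected open subsets of $\mathbb{R}$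 ("open intervals") with inclusions; (pre-)cosheaves are functors $\mathscr{F}:\mathbf{Int}\to\mathbf{Set}$ (with the usual colimit property for cosheaves). The costalk at $x$ is $\mathscr{F}_x=\varprojlim_{I\ni x}\mathscr{F}(I)$. The display locale $\mathcal{D}(\mathscr{F})$ is the set $\coprod_{x\in\mathbb{R}}\mathscr{F}_x$ with the topology generated by the sets $U_{I,a}=\{s\in\mathscr{F}_x: x\in I,\ s\mapsto a\in\mathscr{F}(I)\}$ for $I\in\mathbf{Int}$, $a\in\mathscr{F}(I)$, with its natural projection to $\mathbb{R}$. Spaces. $\mathbb{X}\subset\mathbb{R}^d$ is compact and locally path connected, $f:\mathbb{R}^d\to\mathbb{R}$ is continuous, and $(\mathbb{X},f)$, meaning $(\mathbb{X},f|_\mathbb{X})$, is a constructible $\mathbb{R}$-space. Cover. $\mathcal{U}$ is a nice cover of $\mathbb{R}$: an open cover by open intervals, all nonempty intersections contractible, and $\mathcal{U}_x=\{V\in\mathcal{U}:x\in V\}$ finite for every $x$. $\mathcal{U}'$ is the set of all intersections $\bigcap_{\alpha\in A}U_\alpha$ of families $\{U_\alpha\}_{\alpha\in A}\subset\mathcal{U}$. $\mathcal{I}_\mathcal{U}(U)=\bigcup_{x\in U}\bigcap_{V\in\mathcal{U}_x}V$. $\operatorname{res}_f\mathcal{U}=\max\{\operatorname{diam}V:V\in\mathcal{U},\ V\cap f(\mathbb{X})\neq\emptyset\}\in[0,+\infty]$ (unbounded intervals have infinite diameter). Thickenings and densities. $p:\mathbb{R}^d\to\mathbb{R}$ is a probability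 density function. For $\delta\ge 0$, $\mathbb{X}_\delta=\{y:\inf_{x\in\mathbb{X}}d(x,y)\le\delta\}$; $D_L=p^{-1}([L,+\infty))$; for open $V\subset\mathbb{R}$, $\mathbb{X}^V=\mathbb{X}\cap f^{-1}(V)$, $\mathbb{X}_\delta^V=\mathbb{X}_\delta\cap f^{-1}(V)$, $D_L^V=D_L\cap f^{-1}(V)$. $H_0$ is degree-$0$ singular homology with field coefficients; all maps are induced by inclusions. $p$ is $\epsilon$-concentrated on $\mathbb{X}$ if there are open intervals $I_1,I_2$ and $\delta>0$ with $\mathbb{X}\subset D_{L_1}\subset\mathbb{X}_\delta\subset D_{L_2}\subset\mathbb{X}_\epsilon$ for all $L_1\in I_1$, $L_2\in I_2$. The local $H_0$-critical value over $V$ is $\delta_V=\sup\{\delta: H_0(\mathbb{X}^V)\to H_0(\mathbb{X}^V_{\delta'})\text{ is an isomorphism for all }0\le\delta'\le\delta\}$, and $\delta_\mathcal{U}=\min_{V\in\mathcal{U}'}\delta_V$. A real number $L$ is $H_0$-regular over $V$ if there is $\nu>0$ such that $H_0(D^V_{e_2})\to H_0(D^V_{e_1})$ is an isomorphism for all $e_1<e_2$ in $(L-\nu,L+\nu)$; $(L-\nu,L+\nu)$ is then an $H_0$-regularity range of $L$ over $V$. Standing assumptions: $\delta_\mathcal{U}>0$; $p$ is tame (for each open $V$ the set of $L$ that are $H_0$-regular over $V$ is dense in $\mathbb{R}$). Choice of constants. Given the concentration hypothesis, $L_1,L_2,\delta_1,\delta_2$ are fixed with $\mathbb{X}\subset D_{L_1}\subset\mathbb{X}_{\delta_1}\subset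 D_{L_2}\subset\mathbb{X}_{\delta_2}$, $0<\delta_1<\delta_2<\delta_\mathcal{U}$, and $L_1,L_2$ $H_0$-regular over every $V\in\mathcal{U}'$; and $\varepsilon_1,\varepsilon_2>0$ are fixed so that $L_i\pm2\varepsilon_i$ lie in the $H_0$-regularity range of $L_i$ over $V$ for every $V\in\mathcal{U}'$, and $L_1-2\varepsilon_1>L_2+2\varepsilon_2$. Estimators. $X_1,\dots,X_n$ are i.i.d. with density $p$. $K:\mathbb{R}^d\to[0,1]$ is a kernel with support in the unit ball $B_1(0)$, smooth in $B_1(0)$, $\max K=K(0)=1$, $\int K=C_K\in(0,1)$; $K_r(x)=K(x/r)$; $\hat p(x)=\frac{1}{C_Knr^d}\sum_{i=1}^nK_r(x-X_i)$. $\hat D_L=\bigcup_{i:\hat p(X_i)\ge L}B_r(X_i)$ and $\hat D_L^V=\hat D_L\cap f^{-1}(V)$. "W.h.p." means with probability tending to $1$ as $n\to\infty$. The bandwidth $r=r(n)$ satisfies $nr^d\ge\max(C_{\varepsilon_1},C_{\varepsilon_2})\log n$, where $C_\varepsilon>0$ denotes a constant, independent of $L$ and $V$, such that $nr^d\ge C_\varepsilon\log n$ guarantees, for each fixed $L$ and open $V$, that w.h.p. $D^V_{L+2\varepsilon}\subset\hat D^V_{L+\varepsilon}\subset D^V_L\subset\hat D^V_{L-\varepsilon}\subset D^V_{L-2\varepsilon}$. The random cosheaf $\hat{\mathscr{D}}^\pi_n$ is given by $$\hat{\mathscr{D}}^\pi_n(U)=\operatorname{Im}\left(\pi_0\big(\hat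 D_{L_1+\varepsilon_1}^{\mathcal{I}_\mathcal{U}(U)}\big)\to\pi_0\big(\hat D_{L_2-\varepsilon_2}^{\mathcal{I}_\mathcal{U}(U)}\big)\right)$$ for each open interval $U$ ($\pi_0$ denotes the set of path components), with structure maps induced by inclusion.
   Formalization: The formal theorem additionally assumes that, with probability tending to 1, the random cosheaf really has the cosheaf colimit property; this can fail when one cover member contains another, and then the claimed bound can be false. *)

theory Defs
  imports "HOL-Probability.Probability" "HOL-Homology.Homology"
begin

section \<open>\<open>\<real>\<close>-spaces\<close>

type_synonym 'y rspace = "'y topology \<times> ('y \<Rightarrow> real)"

definition rspace_map :: "'y rspace \<Rightarrow> 'z rspace \<Rightarrow> ('y \<Rightarrow> 'z) \<Rightarrow> bool" where
  "rspace_map Y Z \<alpha> \<longleftrightarrow>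
     continuous_map (fst Y) (fst Z) \<alpha> \<and> (\<forall>y \<in> topspace (fst Y). snd Z (\<alpha> y) = snd Y y)"

subsection \<open>Constructible \<open>\<real>\<close>-spaces\<close>

text \<open>
  The coproduct of the \<open>V i \<times> {a i}\<close> (\<open>i \<le> m\<close>, tagged \<open>Inl i\<close>) and of the
  \<open>E i \<times> [a i, a (i + 1)]\<close> (\<open>i < m\<close>, tagged \<open>Inr i\<close>).
\<close>

definition strata_sum ::
  "nat \<Rightarrow> (nat \<Rightarrow> real) \<Rightarrow> (nat \<Rightarrow> 'v topology) \<Rightarrow> (nat \<Rightarrow> 'v topology)
     \<Rightarrow> ((nat + nat) \<times> 'v \<times> real) topology" where
  "strata_sum m a V E =
     sum_topology
       (case_sum (\<lambda>i. prod_topology (V i) (top_of_set {a i}))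
                 (\<lambda>i. prod_topology (E i) (top_of_set {a i..a (Suc i)})))
       (Inl ` {..m} \<union> Inr ` {..<m})"

inductive strata_glue ::
  "nat \<Rightarrow> (nat \<Rightarrow> real) \<Rightarrow> (nat \<Rightarrow> 'v topology) \<Rightarrow> (nat \<Rightarrow> 'v \<Rightarrow> 'v) \<Rightarrow> (nat \<Rightarrow> 'v \<Rightarrow> 'v)
     \<Rightarrow> (nat + nat) \<times> 'v \<times> real \<Rightarrow> (nat + nat) \<times> 'v \<times> real \<Rightarrow> bool"
  for m a E l r where
  left: "i < m \<Longrightarrow> x \<in> topspace (E i) \<Longrightarrow>
           strata_glue m a E l r (Inl i, l i x, a i) (Inr i, x, a i)"
| right: "i < m \<Longrightarrow> x \<in> topspace (E i) \<Longrightarrow>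
           strata_glue m a E l r (Inl (Suc i), r i x, a (Suc i)) (Inr i, x, a (Suc i))"

text \<open>
  The strata may be taken over the type of points of the total space without loss of generality:
  \<open>V i\<close> embeds into the fibre over \<open>a i\<close>, and \<open>E i\<close> into the fibre over any inner point of
  \<open>[a i, a (i + 1)]\<close>. Being the quotient (up to homeomorphism over the reals) is expressed by a
  quotient map from the coproduct whose fibres are the classes of the generated equivalence.
\<close>

definition constructible :: "'y rspace \<Rightarrow> bool" where
  "constructible Y \<longleftrightarrow>
     (\<exists>(m::nat) (a :: nat \<Rightarrow> real) (V :: nat \<Rightarrow> 'y topology) (E :: nat \<Rightarrow> 'y topology) l r q.
        (\<forall>i<m. a i < a (Suc i)) \<and>
        (\<forall>i\<le>m. locally_path_connected_space (V i)) \<and>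
        (\<forall>i<m. locally_path_connected_space (E i)) \<and>
        (\<forall>i<m. continuous_map (E i) (V i) (l i) \<and> continuous_map (E i) (V (Suc i)) (r i)) \<and>
        quotient_map (strata_sum m a V E) (fst Y) q \<and>
        (\<forall>u \<in> topspace (strata_sum m a V E). snd Y (q u) = snd (snd u)) \<and>
        (\<forall>u \<in> topspace (strata_sum m a V E). \<forall>v \<in> topspace (strata_sum m a V E).
           q u = q v \<longleftrightarrow> equivclp (strata_glue m a E l r) u v))"

subsection \<open>Reeb graphs\<close>

definition quotient_topology :: "'y topology \<Rightarrow> ('y \<Rightarrow> 'z) \<Rightarrow> 'z topology" where
  "quotient_topology Y q =
     topology (\<lambda>U. U \<subseteq> q ` topspace Y \<and> openin Y {y \<in> topspace Y. q y \<in> U})"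

lemma openin_quotient_topology:
  "openin (quotient_topology Y q) U \<longleftrightarrow>
     U \<subseteq> q ` topspace Y \<and> openin Y {y \<in> topspace Y. q y \<in> U}"
proof -
  have "istopology (\<lambda>U. U \<subseteq> q ` topspace Y \<and> openin Y {y \<in> topspace Y. q y \<in> U})"
  proof (unfold istopology_def, intro conjI allI impI)
    fix S T
    assume "S \<subseteq> q ` topspace Y \<and> openin Y {y \<in> topspace Y. q y \<in> S}"
      and "T \<subseteq> q ` topspace Y \<and> openin Y {y \<in> topspace Y. q y \<in> T}"
    moreover have "{y \<in> topspace Y. q y \<in> S \<inter> T} =
        {y \<in> topspace Y. q y \<in> S} \<inter> {y \<in> topspace Y. q y \<in> T}"
      by auto
    ultimately show "S \<inter> T \<subseteq> q ` topspace Y" "openin Y {y \<in> topspace Y. q y \<in> S \<inter> T}"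
      by auto
  next
    fix \<K>
    assume *: "\<forall>K\<in>\<K>. K \<subseteq> q ` topspace Y \<and> openin Y {y \<in> topspace Y. q y \<in> K}"
    then show "\<Union>\<K> \<subseteq> q ` topspace Y"
      by auto
    have "{y \<in> topspace Y. q y \<in> \<Union>\<K>} = (\<Union>K\<in>\<K>. {y \<in> topspace Y. q y \<in> K})"
      by auto
    then show "openin Y {y \<in> topspace Y. q y \<in> \<Union>\<K>}"
      using * by auto
  qed
  then show ?thesis
    by (simp add: quotient_topology_def)
qed

definition reeb_class :: "'y rspace \<Rightarrow> 'y \<Rightarrow> 'y set" where
  "reeb_class Y y =
     connected_component_of_set (subtopology (fst Y) {z. snd Y z = snd Y y}) y"

text \<open>In the next two definitions the image is a singleton for every point \<open>C\<close> of the Reeb graph.\<close>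

definition reeb_graph :: "'y rspace \<Rightarrow> 'y set rspace" where
  "reeb_graph Y = (quotient_topology (fst Y) (reeb_class Y), \<lambda>C. the_elem (snd Y ` C))"

definition reeb_map :: "'z rspace \<Rightarrow> ('y \<Rightarrow> 'z) \<Rightarrow> 'y set \<Rightarrow> 'z set" where
  "reeb_map Z \<alpha> C = the_elem ((\<lambda>y. reeb_class Z (\<alpha> y)) ` C)"

subsection \<open>Smoothing and the Reeb distance\<close>

definition thicken :: "real \<Rightarrow> 'y rspace \<Rightarrow> ('y \<times> real) rspace" where
  "thicken \<epsilon> Y = (prod_topology (fst Y) (top_of_set {-\<epsilon>..\<epsilon>}), \<lambda>(y, t). snd Y y + t)"

definition smoothing :: "real \<Rightarrow> 'y rspace \<Rightarrow> ('y \<times> real) set rspace" where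
  "smoothing \<epsilon> Y = reeb_graph (thicken \<epsilon> Y)"

definition smoothing_map ::
  "real \<Rightarrow> 'z rspace \<Rightarrow> ('y \<Rightarrow> 'z) \<Rightarrow> ('y \<times> real) set \<Rightarrow> ('z \<times> real) set" where
  "smoothing_map \<epsilon> Z \<alpha> = reeb_map (thicken \<epsilon> Z) (map_prod \<alpha> id)"

definition zeta :: "real \<Rightarrow> 'y rspace \<Rightarrow> 'y \<Rightarrow> ('y \<times> real) set" where
  "zeta \<epsilon> Y y = reeb_class (thicken \<epsilon> Y) (y, 0)"

definition interleaved :: "real \<Rightarrow> 'y rspace \<Rightarrow> 'z rspace \<Rightarrow> bool" where
  "interleaved \<epsilon> F G \<longleftrightarrow>
     (\<exists>\<alpha> \<beta>. rspace_map F (smoothing \<epsilon> G) \<alpha> \<and> rspace_map G (smoothing \<epsilon> F) \<beta> \<and>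
        (\<forall>x \<in> topspace (fst F).
           smoothing_map \<epsilon> (smoothing \<epsilon> F) \<beta> (\<alpha> x) = zeta \<epsilon> (smoothing \<epsilon> F) (zeta \<epsilon> F x)) \<and>
        (\<forall>y \<in> topspace (fst G).
           smoothing_map \<epsilon> (smoothing \<epsilon> G) \<alpha> (\<beta> y) = zeta \<epsilon> (smoothing \<epsilon> G) (zeta \<epsilon> G y)))"

text \<open>
  The formula for graphs over the reals makes sense for all \<open>\<real>\<close>-spaces; the value is \<open>\<infinity>\<close> if
  there is no interleaving at all.
\<close>

definition reeb_dist :: "'y rspace \<Rightarrow> 'z rspace \<Rightarrow> ennreal" where
  "reeb_dist F G = Inf {ennreal \<epsilon> | \<epsilon>. 0 \<le> \<epsilon> \<and> interleaved \<epsilon> F G}"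

section \<open>Cosheaves on open intervals and the display locale\<close>

definition open_intervals :: "real set set" where
  "open_intervals = {I. open I \<and> connected I \<and> I \<noteq> {}}"

text \<open>
  A precosheaf is given by its values \<open>F I\<close> and, for \<open>I \<subseteq> J\<close>, its structure maps
  \<open>\<phi> I J : F I \<Rightarrow> F J\<close>.
\<close>

definition precosheaf :: "(real set \<Rightarrow> 'c set) \<Rightarrow> (real set \<Rightarrow> real set \<Rightarrow> 'c \<Rightarrow> 'c) \<Rightarrow> bool" where
  "precosheaf F \<phi> \<longleftrightarrow>
     (\<forall>I \<in> open_intervals. \<forall>J \<in> open_intervals. I \<subseteq> J \<longrightarrow> \<phi> I J ` F I \<subseteq> F J) \<and>
     (\<forall>I \<in> open_intervals. \<forall>a \<in> F I. \<phi> I I a = a) \<and>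
     (\<forall>I \<in> open_intervals. \<forall>J \<in> open_intervals. \<forall>K \<in> open_intervals. I \<subseteq> J \<longrightarrow> J \<subseteq> K \<longrightarrow>
        (\<forall>a \<in> F I. \<phi> J K (\<phi> I J a) = \<phi> I K a))"

inductive overlap ::
  "(real set \<Rightarrow> 'c set) \<Rightarrow> (real set \<Rightarrow> real set \<Rightarrow> 'c \<Rightarrow> 'c) \<Rightarrow> real set set
     \<Rightarrow> real set \<times> 'c \<Rightarrow> real set \<times> 'c \<Rightarrow> bool"
  for F \<phi> \<V> where
  "J \<in> \<V> \<Longrightarrow> J' \<in> \<V> \<Longrightarrow> J \<inter> J' \<noteq> {} \<Longrightarrow> c \<in> F (J \<inter> J') \<Longrightarrow>
     overlap F \<phi> \<V> (J, \<phi> (J \<inter> J') J c) (J', \<phi> (J \<inter> J') J' c)"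

text \<open>
  The colimit property: for every cover \<open>\<V>\<close> of \<open>I\<close> by open intervals, \<open>F I\<close> is the coequalizer
  of \<open>\<Coprod> F (J \<inter> J') \<rightrightarrows> \<Coprod> F J\<close>, written out for sets as the quotient of the
  disjoint union by the equivalence relation that the overlaps generate.
\<close>

definition cosheaf :: "(real set \<Rightarrow> 'c set) \<Rightarrow> (real set \<Rightarrow> real set \<Rightarrow> 'c \<Rightarrow> 'c) \<Rightarrow> bool" where
  "cosheaf F \<phi> \<longleftrightarrow>
     precosheaf F \<phi> \<and>
     (\<forall>I \<in> open_intervals. \<forall>\<V>. \<V> \<subseteq> open_intervals \<and> \<Union>\<V> = I \<longrightarrow>
        (\<forall>a \<in> F I. \<exists>J \<in> \<V>. \<exists>b \<in> F J. \<phi> J I b = a) \<and>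
        (\<forall>J \<in> \<V>. \<forall>J' \<in> \<V>. \<forall>b \<in> F J. \<forall>b' \<in> F J'.
           \<phi> J I b = \<phi> J' I b' \<longleftrightarrow> equivclp (overlap F \<phi> \<V>) (J, b) (J', b')))"

definition costalk ::
  "(real set \<Rightarrow> 'c set) \<Rightarrow> (real set \<Rightarrow> real set \<Rightarrow> 'c \<Rightarrow> 'c) \<Rightarrow> real \<Rightarrow> (real set \<Rightarrow> 'c) set" where
  "costalk F \<phi> x =
     {s \<in> (\<Pi>\<^sub>E I \<in> {I \<in> open_intervals. x \<in> I}. F I).
        \<forall>I \<in> open_intervals. \<forall>J \<in> open_intervals. x \<in> I \<longrightarrow> I \<subseteq> J \<longrightarrow> \<phi> I J (s I) = s J}"

definition display_cell ::
  "(real set \<Rightarrow> 'c set) \<Rightarrow> (real set \<Rightarrow> real set \<Rightarrow> 'c \<Rightarrow> 'c) \<Rightarrow> real set \<Rightarrow> 'c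
     \<Rightarrow> (real \<times> (real set \<Rightarrow> 'c)) set" where
  "display_cell F \<phi> I a = {(x, s). x \<in> I \<and> s \<in> costalk F \<phi> x \<and> s I = a}"

text \<open>The cells over the whole line already cover the disjoint union of all costalks.\<close>

definition display_locale ::
  "(real set \<Rightarrow> 'c set) \<Rightarrow> (real set \<Rightarrow> real set \<Rightarrow> 'c \<Rightarrow> 'c)
     \<Rightarrow> (real \<times> (real set \<Rightarrow> 'c)) rspace" where
  "display_locale F \<phi> =
     (topology_generated_by {display_cell F \<phi> I a | I a. I \<in> open_intervals \<and> a \<in> F I}, fst)"

section \<open>Covers of the line\<close>

definition nice_cover :: "real set set \<Rightarrow> bool" where
  "nice_cover \<U> \<longleftrightarrow>
     \<U> \<subseteq> open_intervals \<and> \<Union>\<U> = UNIV \<and>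
     (\<forall>A. A \<subseteq> \<U> \<and> A \<noteq> {} \<and> \<Inter>A \<noteq> {} \<longrightarrow> contractible (\<Inter>A)) \<and>
     (\<forall>x. finite {V \<in> \<U>. x \<in> V})"

definition cover_inters :: "real set set \<Rightarrow> real set set" where
  "cover_inters \<U> = {\<Inter>A | A. A \<subseteq> \<U> \<and> A \<noteq> {}}"

definition cover_hull :: "real set set \<Rightarrow> real set \<Rightarrow> real set" where
  "cover_hull \<U> U = (\<Union>x\<in>U. \<Inter>{V \<in> \<U>. x \<in> V})"

definition ediam :: "real set \<Rightarrow> ennreal" where
  "ediam V = (SUP x\<in>V. SUP y\<in>V. ennreal (dist x y))"

definition resolution :: "('a \<Rightarrow> real) \<Rightarrow> 'a set \<Rightarrow> real set set \<Rightarrow> ennreal" where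
  "resolution f X \<U> = (SUP V \<in> {V \<in> \<U>. V \<inter> f ` X \<noteq> {}}. ediam V)"

section \<open>Singular homology with field coefficients\<close>

type_synonym ('a, 'k) kchain = "((nat \<Rightarrow> real) \<Rightarrow> 'a) \<Rightarrow>\<^sub>0 'k"

definition kchains :: "nat \<Rightarrow> 'a topology \<Rightarrow> ('a, 'k::field) kchain set" where
  "kchains p X = {c. Poly_Mapping.keys c \<subseteq> singular_simplex_set p X}"

definition kboundary :: "nat \<Rightarrow> ('a, 'k::field) kchain \<Rightarrow> ('a, 'k) kchain" where
  "kboundary p c =
     (if p = 0 then 0
      else \<Sum>\<sigma> \<in> Poly_Mapping.keys c. \<Sum>i\<le>p.
             Poly_Mapping.single (singular_face p i \<sigma>) ((-1) ^ i * Poly_Mapping.lookup c \<sigma>))"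

definition kcycles :: "nat \<Rightarrow> 'a topology \<Rightarrow> ('a, 'k::field) kchain set" where
  "kcycles p X = {c \<in> kchains p X. kboundary p c = 0}"

definition khomologous ::
  "nat \<Rightarrow> 'a topology \<Rightarrow> (('a, 'k::field) kchain \<times> ('a, 'k) kchain) set" where
  "khomologous p X =
     {(c, c'). c \<in> kcycles p X \<and> c' \<in> kcycles p X \<and> c - c' \<in> kboundary (Suc p) ` kchains (Suc p) X}"

definition khomology :: "nat \<Rightarrow> 'a topology \<Rightarrow> ('a, 'k::field) kchain set set" where
  "khomology p X = kcycles p X // khomologous p X"

text \<open>
  For \<open>S \<subseteq> T\<close>, the map \<open>H\<^sub>0(S; k) \<rightarrow> H\<^sub>0(T; k)\<close> induced by the inclusion sends
  the class \<open>z\<close> to the class in \<open>T\<close> of any cycle in \<open>z\<close>. It is linear, so it is an isomorphism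
  iff it is bijective. The first argument only carries the field \<open>k\<close>.
\<close>

definition H0_incl_iso ::
  "'k::field itself \<Rightarrow> 'a::topological_space set \<Rightarrow> 'a set \<Rightarrow> bool" where
  "H0_incl_iso k S T \<longleftrightarrow>
     bij_betw (\<lambda>z. (khomologous 0 (top_of_set T) :: (('a, 'k) kchain \<times> ('a, 'k) kchain) set) `` z)
       (khomology 0 (top_of_set S)) (khomology 0 (top_of_set T))"

section \<open>Thickenings and superlevel sets\<close>

text \<open>\<^const>\<open>infdist\<close> is \<open>0\<close> for the empty set, where the infimum of distances is \<open>\<infinity>\<close>.\<close>

definition thickening :: "'a::metric_space set \<Rightarrow> real \<Rightarrow> 'a set" where
  "thickening X \<delta> = {y. X \<noteq> {} \<and> infdist y X \<le> \<delta>}"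

definition superlevel :: "('a \<Rightarrow> real) \<Rightarrow> real \<Rightarrow> 'a set" where
  "superlevel p L = p -` {L..}"

definition over :: "('a \<Rightarrow> real) \<Rightarrow> 'a set \<Rightarrow> real set \<Rightarrow> 'a set" where
  "over f S V = S \<inter> f -` V"

definition concentrated :: "('a::metric_space \<Rightarrow> real) \<Rightarrow> 'a set \<Rightarrow> real \<Rightarrow> bool" where
  "concentrated p X \<epsilon> \<longleftrightarrow>
     (\<exists>I1 \<in> open_intervals. \<exists>I2 \<in> open_intervals. \<exists>\<delta>>0. \<forall>L1 \<in> I1. \<forall>L2 \<in> I2.
        X \<subseteq> superlevel p L1 \<and> superlevel p L1 \<subseteq> thickening X \<delta> \<and>
        thickening X \<delta> \<subseteq> superlevel p L2 \<and> superlevel p L2 \<subseteq> thickening X \<epsilon>)"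

definition local_critical_value ::
  "'k::field itself \<Rightarrow> ('a::metric_space \<Rightarrow> real) \<Rightarrow> 'a set \<Rightarrow> real set \<Rightarrow> ennreal" where
  "local_critical_value k f X V =
     Sup {ennreal \<delta> | \<delta>. 0 \<le> \<delta> \<and>
            (\<forall>\<delta>' \<in> {0..\<delta>}. H0_incl_iso k (over f X V) (over f (thickening X \<delta>') V))}"

definition cover_critical_value ::
  "'k::field itself \<Rightarrow> ('a::metric_space \<Rightarrow> real) \<Rightarrow> 'a set \<Rightarrow> real set set \<Rightarrow> ennreal" where
  "cover_critical_value k f X \<U> = (INF V \<in> cover_inters \<U>. local_critical_value k f X V)"

definition regularity_range ::
  "'k::field itself \<Rightarrow> ('a::topological_space \<Rightarrow> real) \<Rightarrow> ('a \<Rightarrow> real) \<Rightarrow> real set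
     \<Rightarrow> real \<Rightarrow> real set \<Rightarrow> bool" where
  "regularity_range k f p V L R \<longleftrightarrow>
     (\<exists>\<nu>>0. R = {L - \<nu><..<L + \<nu>} \<and>
        (\<forall>e1 \<in> R. \<forall>e2 \<in> R. e1 < e2 \<longrightarrow>
           H0_incl_iso k (over f (superlevel p e2) V) (over f (superlevel p e1) V)))"

definition H0_regular ::
  "'k::field itself \<Rightarrow> ('a::topological_space \<Rightarrow> real) \<Rightarrow> ('a \<Rightarrow> real) \<Rightarrow> real set \<Rightarrow> real \<Rightarrow> bool" where
  "H0_regular k f p V L \<longleftrightarrow> (\<exists>R. regularity_range k f p V L R)"

definition tame :: "'k::field itself \<Rightarrow> ('a::topological_space \<Rightarrow> real) \<Rightarrow> ('a \<Rightarrow> real) \<Rightarrow> bool" where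
  "tame k f p \<longleftrightarrow> (\<forall>V. open V \<longrightarrow> closure {L. H0_regular k f p V L} = UNIV)"

section \<open>Kernel estimators\<close>

primrec Ck_on :: "nat \<Rightarrow> 'a::euclidean_space set \<Rightarrow> ('a \<Rightarrow> real) \<Rightarrow> bool" where
  "Ck_on 0 S g \<longleftrightarrow> continuous_on S g"
| "Ck_on (Suc k) S g \<longleftrightarrow>
     (\<forall>x \<in> S. g differentiable (at x)) \<and>
     (\<forall>v. Ck_on k S (\<lambda>x. frechet_derivative g (at x) v))"

definition kernel :: "('a::euclidean_space \<Rightarrow> real) \<Rightarrow> real \<Rightarrow> bool" where
  "kernel K CK \<longleftrightarrow>
     range K \<subseteq> {0..1} \<and> K 0 = 1 \<and>
     closure {x. K x \<noteq> 0} \<subseteq> cball 0 1 \<and> (\<forall>k. Ck_on k (ball 0 1) K) \<and>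
     has_bochner_integral lborel K CK \<and> 0 < CK \<and> CK < 1"

definition kde ::
  "('a::euclidean_space \<Rightarrow> real) \<Rightarrow> real \<Rightarrow> real \<Rightarrow> nat \<Rightarrow> (nat \<Rightarrow> 'a) \<Rightarrow> 'a \<Rightarrow> real" where
  "kde K CK r n \<xi> x =
     1 / (CK * real n * r ^ DIM('a)) * (\<Sum>i = 1..n. K ((x - \<xi> i) /\<^sub>R r))"

definition level_estimator ::
  "('a::euclidean_space \<Rightarrow> real) \<Rightarrow> real \<Rightarrow> real \<Rightarrow> nat \<Rightarrow> (nat \<Rightarrow> 'a) \<Rightarrow> real \<Rightarrow> 'a set" where
  "level_estimator K CK r n \<xi> L = (\<Union>i \<in> {i \<in> {1..n}. L \<le> kde K CK r n \<xi> (\<xi> i)}. ball (\<xi> i) r)"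

definition level_sandwich ::
  "('a \<Rightarrow> real) \<Rightarrow> ('a \<Rightarrow> real) \<Rightarrow> (real \<Rightarrow> 'a set) \<Rightarrow> real \<Rightarrow> real \<Rightarrow> real set \<Rightarrow> bool" where
  "level_sandwich f p D \<epsilon> L V \<longleftrightarrow>
     over f (superlevel p (L + 2 * \<epsilon>)) V \<subseteq> over f (D (L + \<epsilon>)) V \<and>
     over f (D (L + \<epsilon>)) V \<subseteq> over f (superlevel p L) V \<and>
     over f (superlevel p L) V \<subseteq> over f (D (L - \<epsilon>)) V \<and>
     over f (D (L - \<epsilon>)) V \<subseteq> over f (superlevel p (L - 2 * \<epsilon>)) V"

text \<open>
  The events below need not be measurable. Their probability is taken as inner probability, which
  agrees with \<^const>\<open>measure\<close> on measurable events; limit \<open>1\<close> for the inner probability is the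
  strongest reading of limit \<open>1\<close> (for \<^const>\<open>measure\<close> a nonmeasurable event has value \<open>0\<close>).
\<close>

definition inner_prob :: "'w measure \<Rightarrow> 'w set \<Rightarrow> real" where
  "inner_prob M E = Sup {measure M A | A. A \<in> sets M \<and> A \<subseteq> E}"

definition whp :: "'w measure \<Rightarrow> (nat \<Rightarrow> 'w \<Rightarrow> bool) \<Rightarrow> bool" where
  "whp M E \<longleftrightarrow> (\<lambda>n. inner_prob M {\<omega> \<in> space M. E n \<omega>}) \<longlonglongrightarrow> 1"

section \<open>The mapper cosheaf of two nested sets\<close>

definition pi0 :: "'a::topological_space set \<Rightarrow> 'a set set" where
  "pi0 S = path_component_set S ` S"

text \<open>The map \<open>\<pi>\<^sub>0(S) \<rightarrow> \<pi>\<^sub>0(T)\<close> induced by an inclusion \<open>S \<subseteq> T\<close>.\<close>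

definition pi0_incl :: "'a::topological_space set \<Rightarrow> 'a set \<Rightarrow> 'a set" where
  "pi0_incl T C = (\<Union>x\<in>C. path_component_set T x)"

text \<open>
  This is always a precosheaf. It can fail to be a cosheaf: an image of a map of cosheaves need not
  be one, and \<^const>\<open>cover_hull\<close> need not respect intersections of overlapping intervals when
  one member of the cover contains another.
\<close>

definition mapper_cosheaf ::
  "('a::topological_space \<Rightarrow> real) \<Rightarrow> real set set \<Rightarrow> 'a set \<Rightarrow> 'a set \<Rightarrow> real set \<Rightarrow> 'a set set" where
  "mapper_cosheaf f \<U> S T U =
     pi0_incl (over f T (cover_hull \<U> U)) ` pi0 (over f S (cover_hull \<U> U))"

definition mapper_cosheaf_map ::
  "('a::topological_space \<Rightarrow> real) \<Rightarrow> real set set \<Rightarrow> 'a set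
     \<Rightarrow> real set \<Rightarrow> real set \<Rightarrow> 'a set \<Rightarrow> 'a set" where
  "mapper_cosheaf_map f \<U> T U W = pi0_incl (over f T (cover_hull \<U> W))"

end

(*
  For x on the line let U_x (core U x in the code) be the intersection of the cover members that
  contain x. If an interval I satisfies x : I <= U_x, then I has hull U_x, so every costalk of the
  mapper cosheaf is its value at U_x. Degree-zero homology detects path components, hence the chains
  of isomorphisms given by regularity of the levels and by the critical value identify this value
  with the components of X over U_x, as soon as the two sandwiches hold over the whole line. A point
  of the display locale is thus a pair of x and a component C of X over U_x.

  Sending y to the component of y over U_(f y) gives a map from the Reeb graph to the display locale.
  In the other direction (x, C) goes to the class of (y, x - f y) for any y in C, a point of the
  smoothing because U_x has diameter at most the resolution; it is continuous since the closure of C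
  is compact. One triangle commutes by construction. For the other one, (x, C) has to be joined to
  the image of y, and this is where the cosheaf property enters: it makes the cell of C over U_x
  connected.
*)
theory Submission
  imports Defs
begin

section \<open>Degree-zero homology and path components\<close>

text \<open>The cover may give infinitely many sets U_x, and an intersection of infinitely many
  events of high probability need not have high probability. Over the whole line a sandwich is an
  inclusion of the sets themselves, so one event restricts to all U_x at once. The main obstacle is
  the connectedness of a cell. The cosheaf property speaks about covers by intervals, whereas the
  size of a small cell depends on x and on the component. One radius therefore has to serve all
  components over U_x. These are finite in number, and this is where constructibility enters. The
  continuity of the map to the smoothing meets a different difficulty: the level may vary only by an
  amount that is uniform along C, and C need not be compact because U_x is open. Passing to the
  closure is possible since X is closed and the bound on the difference of levels survives
  limits.\<close>

lemma sum_keys_superset: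
  fixes g :: "'a \<Rightarrow> 'b::zero \<Rightarrow> 'c::comm_monoid_add"
  assumes "finite B" "Poly_Mapping.keys c \<subseteq> B" "\<And>\<sigma>. g \<sigma> 0 = 0"
  shows "(\<Sum>\<sigma>\<in>Poly_Mapping.keys c. g \<sigma> (Poly_Mapping.lookup c \<sigma>)) = (\<Sum>\<sigma>\<in>B. g \<sigma> (Poly_Mapping.lookup c \<sigma>))"
  by (rule sum.mono_neutral_left) (use assms in \<open>auto simp: in_keys_iff\<close>)

text \<open>Cancellation may shrink the support of \<open>c - d\<close>, so all three sums are
  extended by zero terms to the union of the two supports, where they can be compared term by
  term.\<close>

lemma sum_keys_diff:
  fixes g :: "'a \<Rightarrow> 'b::ab_group_add \<Rightarrow> 'c::ab_group_add"
  assumes g: "\<And>\<sigma> a b. g \<sigma> (a - b) = g \<sigma> a - g \<sigma> b"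
  shows "(\<Sum>\<sigma>\<in>Poly_Mapping.keys (c - d). g \<sigma> (Poly_Mapping.lookup (c - d) \<sigma>)) =
    (\<Sum>\<sigma>\<in>Poly_Mapping.keys c. g \<sigma> (Poly_Mapping.lookup c \<sigma>)) -
    (\<Sum>\<sigma>\<in>Poly_Mapping.keys d. g \<sigma> (Poly_Mapping.lookup d \<sigma>))"
proof -
  let ?B = "Poly_Mapping.keys c \<union> Poly_Mapping.keys d"
  have g0: "g \<sigma> 0 = 0" for \<sigma>
    using g[of \<sigma> 0 0] by simp
  have "Poly_Mapping.keys (c - d) \<subseteq> ?B"
    by (rule keys_diff)
  then show ?thesis
    unfolding sum_keys_superset[of ?B _ g, OF _ \<open>Poly_Mapping.keys (c - d) \<subseteq> ?B\<close> g0, simplified]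
      sum_keys_superset[of ?B c g, OF _ _ g0, simplified] sum_keys_superset[of ?B d g, OF _ _ g0, simplified]
    by (simp add: lookup_minus g sum_subtractf)
qed

lemma kboundary_diff:
  "kboundary p (c - d) = kboundary p c - (kboundary p d :: ('a, 'k::field) kchain)"
proof (cases "p = 0")
  case False
  define g where "g \<equiv> \<lambda>\<sigma> a. \<Sum>i\<le>p. Poly_Mapping.single (singular_face p i \<sigma> :: _ \<Rightarrow> 'a) ((-1) ^ i * a :: 'k)"
  have "kboundary p c = (\<Sum>\<sigma>\<in>Poly_Mapping.keys c. g \<sigma> (Poly_Mapping.lookup c \<sigma>))" for c :: "('a, 'k) kchain"
    using False by (simp add: kboundary_def g_def)
  moreover have "g \<sigma> (a - b) = g \<sigma> a - g \<sigma> b" for \<sigma> a b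
    by (simp add: g_def right_diff_distrib single_diff sum_subtractf)
  ultimately show ?thesis
    by (simp add: sum_keys_diff)
qed (simp add: kboundary_def)

lemma kboundary_0 [simp]: "kboundary p 0 = 0"
  using kboundary_diff[of p 0 0] by simp

lemma zero_in_kchains [simp]: "0 \<in> kchains p X"
  by (simp add: kchains_def)

lemma kchains_diff: "c \<in> kchains p X \<Longrightarrow> d \<in> kchains p X \<Longrightarrow> c - d \<in> kchains p X"
  using keys_diff[of c d] by (auto simp: kchains_def)

lemma equiv_khomologous:
  "equiv (kcycles p X) (khomologous p X :: (('a, 'k::field) kchain \<times> ('a, 'k) kchain) set)"
proof -
  let ?B = "kboundary (Suc p) ` (kchains (Suc p) X :: ('a, 'k) kchain set)"
  have B: "b - b' \<in> ?B" if "b \<in> ?B" "b' \<in> ?B" for b b'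
    using that by (auto simp flip: kboundary_diff intro!: imageI kchains_diff)
  have 0: "0 \<in> ?B"
    by (rule image_eqI[of _ _ 0]) auto
  have sym: "d - c \<in> ?B" if "c - d \<in> ?B" for c d
    using B[OF 0 that] by simp
  have trans: "c - e \<in> ?B" if "c - d \<in> ?B" "d - e \<in> ?B" for c d e
    using B[OF that(1) sym[OF that(2)]] by simp
  show ?thesis
    by (intro equivI refl_onI symI transI)
      (use 0 in \<open>auto simp: khomologous_def intro: sym trans simp del: image_iff\<close>)
qed

section \<open>Zero-chains and path components\<close>

abbreviation vertex0 :: "nat \<Rightarrow> real" where
  "vertex0 \<equiv> \<lambda>j. if j = 0 then 1 else 0"

text \<open>Singular simplices are extensional functions, hence the restriction.
  \<open>vertex0\<close> is the only point of the standard 0-simplex, so evaluation there recovers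
  the point; on a 1-simplex it gives the vertex kept by face 1.\<close>

definition point_simplex :: "'a \<Rightarrow> (nat \<Rightarrow> real) \<Rightarrow> 'a" where
  "point_simplex x = restrict (\<lambda>_. x) (standard_simplex 0)"

lemma point_simplex_vertex [simp]: "point_simplex x vertex0 = x"
  by (simp add: point_simplex_def)

lemma singular_simplex_point:
  assumes "x \<in> topspace X"
  shows "singular_simplex 0 X (point_simplex x)"
proof -
  have "continuous_map (subtopology (powertop_real UNIV) (standard_simplex 0)) X (\<lambda>_. x)"
    using assms by simp
  then have "continuous_map (subtopology (powertop_real UNIV) (standard_simplex 0)) X (point_simplex x)"
    by (rule continuous_map_eq) (simp add: point_simplex_def)
  then show ?thesis
    by (simp add: singular_simplex_def point_simplex_def)
qed

text \<open>The augmentation restricted to the simplices based at points of \<open>A\<close>. With a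
  path component for \<open>A\<close> it is the linear functional on degree-zero homology that reads
  off the coordinate of that component.\<close>

definition coeff_sum :: "'a set \<Rightarrow> ('a, 'k::field) kchain \<Rightarrow> 'k" where
  "coeff_sum A c = (\<Sum>\<sigma>\<in>Poly_Mapping.keys c. if \<sigma> vertex0 \<in> A then Poly_Mapping.lookup c \<sigma> else 0)"

lemma coeff_sum_diff: "coeff_sum A (c - d) = coeff_sum A c - coeff_sum A d"
  unfolding coeff_sum_def
  by (rule sum_keys_diff[where g = "\<lambda>\<sigma> a. if \<sigma> vertex0 \<in> A then a else 0"]) auto

lemma coeff_sum_0 [simp]: "coeff_sum A 0 = 0"
  by (simp add: coeff_sum_def)

lemma coeff_sum_add: "coeff_sum A (c + d) = coeff_sum A c + coeff_sum A d"
  using coeff_sum_diff[of A c "- d"] coeff_sum_diff[of A 0 d] by simp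

lemma coeff_sum_sum: "coeff_sum A (sum g B) = (\<Sum>i\<in>B. coeff_sum A (g i))"
  by (induction B rule: infinite_finite_induct) (auto simp: coeff_sum_add)

lemma coeff_sum_single: "coeff_sum A (Poly_Mapping.single \<sigma> a) = (if \<sigma> vertex0 \<in> A then a else 0)"
  by (simp add: coeff_sum_def)

lemma simplical_face_vertex:
  "simplical_face 0 vertex0 = (\<lambda>j. if j = 1 then 1 else 0 :: real)"
  "simplical_face 1 vertex0 = vertex0"
  by (auto simp: simplical_face_def fun_eq_iff)

lemma singular_face_1_vertex0:
  "singular_face 1 0 \<sigma> vertex0 = \<sigma> (\<lambda>j. if j = 1 then 1 else 0)"
  "singular_face 1 1 \<sigma> vertex0 = \<sigma> vertex0"
  using simplical_face_vertex by (auto simp: singular_face_def)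

text \<open>The two faces of a 1-simplex are the endpoints of a path, so both or neither lie in the
  given component; their coefficients have opposite signs and cancel.\<close>

lemma coeff_sum_kboundary:
  fixes c :: "('a::topological_space, 'k::field) kchain"
  assumes c: "c \<in> kchains 1 (top_of_set S)"
  shows "coeff_sum (path_component_set S x) (kboundary 1 c) = 0"
proof -
  let ?A = "path_component_set S x"
  have "coeff_sum ?A (\<Sum>i\<le>1. Poly_Mapping.single (singular_face 1 i \<sigma>) ((-1) ^ i * Poly_Mapping.lookup c \<sigma>)) = 0"
    if "\<sigma> \<in> Poly_Mapping.keys c" for \<sigma>
  proof -
    have "singular_simplex 1 (top_of_set S) \<sigma>"
      using c that by (auto simp: kchains_def)
    then have "path_connectedin (top_of_set S) (\<sigma> ` standard_simplex 1)"
      unfolding singular_simplex_def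
      by (intro path_connectedin_continuous_map_image) (auto simp: path_connectedin_subtopology path_connectedin_standard_simplex)
    then have pc: "path_connected (\<sigma> ` standard_simplex 1)" "\<sigma> ` standard_simplex 1 \<subseteq> S"
      by (auto simp: path_connectedin_subtopology)
    have "path_component S (\<sigma> vertex0) (\<sigma> (\<lambda>j. if j = 1 then 1 else 0))"
      using pc by (intro path_component_of_subset[OF pc(2)]) (auto simp: path_connected_component)
    then have "\<sigma> vertex0 \<in> ?A \<longleftrightarrow> \<sigma> (\<lambda>j. if j = 1 then 1 else 0) \<in> ?A"
      by (auto intro: path_component_trans path_component_sym)
    then show ?thesis
      by (simp add: coeff_sum_add coeff_sum_single singular_face_1_vertex0[simplified One_nat_def])
  qed
  then show ?thesis
    by (simp add: kboundary_def coeff_sum_sum)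
qed

lemma coeff_sum_khomologous:
  fixes c d :: "('a::topological_space, 'k::field) kchain"
  assumes "(c, d) \<in> khomologous 0 (top_of_set S)"
  shows "coeff_sum (path_component_set S x) c = coeff_sum (path_component_set S x) d"
proof -
  obtain b where "b \<in> kchains 1 (top_of_set S)" "c - d = kboundary 1 b"
    using assms by (auto simp: khomologous_def)
  then have "coeff_sum (path_component_set S x) (c - d) = 0"
    by (simp only: coeff_sum_kboundary)
  then show ?thesis
    by (simp add: coeff_sum_diff)
qed

definition point_chain :: "'a \<Rightarrow> ('a, 'k::field) kchain" where
  "point_chain x = Poly_Mapping.single (point_simplex x) 1"

lemma coeff_sum_point_chain: "coeff_sum A (point_chain x) = (if x \<in> A then 1 else 0)"
  by (simp add: point_chain_def coeff_sum_single)

lemma kcycles_0: "kcycles 0 X = kchains 0 X"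
  by (auto simp: kcycles_def kboundary_def)

lemma point_chain_in_kcycles: "x \<in> topspace X \<Longrightarrow> point_chain x \<in> kcycles 0 X"
  by (simp add: kcycles_0 kchains_def point_chain_def singular_simplex_point)

lemma khomologous_mono:
  assumes "S \<subseteq> T"
  shows "khomologous p (top_of_set S) \<subseteq> khomologous p (top_of_set T)"
proof -
  have "kchains p (top_of_set S) \<subseteq> kchains p (top_of_set T)" for p
    using singular_simplex_mono[OF _ assms] by (fastforce simp: kchains_def)
  then show ?thesis
    by (force simp: khomologous_def kcycles_def)
qed

lemma khomologous_point_chain:
  assumes "path_component S x y"
  shows "(point_chain x, point_chain y :: ('a::topological_space, 'k::field) kchain) \<in> khomologous 0 (top_of_set S)"
proof -
  obtain g where g: "path g" "path_image g \<subseteq> S" "pathstart g = y" "pathfinish g = x"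
    using assms path_component_sym unfolding path_component_def by metis
  have xy: "x \<in> S" "y \<in> S"
    using assms path_component_mem by auto
  \<comment> \<open>The coordinate \<open>v 1\<close> parametrizes the 1-simplex by the unit
    interval. Face 0 sits at the end where it is 1, so the path has to run from \<open>y\<close> to
    \<open>x\<close> for the boundary to be the chain of \<open>x\<close> minus that of
    \<open>y\<close>.\<close>
  define \<sigma> where "\<sigma> = restrict (\<lambda>v. g (v 1)) (standard_simplex 1)"
  have "continuous_map (subtopology (powertop_real UNIV) (standard_simplex 1)) (top_of_set {0..1}) (\<lambda>v. v 1)"
    by (auto simp: continuous_map_in_subtopology standard_simplex_def
        intro!: continuous_map_from_subtopology continuous_map_product_projection)
  moreover have "continuous_map (top_of_set {0..1}) (top_of_set S) g"
    using g by (auto simp: path_def path_image_def)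
  ultimately have "continuous_map (subtopology (powertop_real UNIV) (standard_simplex 1)) (top_of_set S) (g \<circ> (\<lambda>v. v 1))"
    by (rule continuous_map_compose)
  then have "continuous_map (subtopology (powertop_real UNIV) (standard_simplex 1)) (top_of_set S) \<sigma>"
    by (rule continuous_map_eq) (simp add: \<sigma>_def)
  then have \<sigma>: "singular_simplex 1 (top_of_set S) \<sigma>"
    by (simp add: singular_simplex_def \<sigma>_def)
  have "singular_face 1 0 \<sigma> = point_simplex x"
    using g simplical_face_vertex(1) basis_in_standard_simplex[of 1 1]
    by (auto simp: singular_face_def point_simplex_def standard_simplex_0 \<sigma>_def restrict_def pathfinish_def)
  moreover have "singular_face 1 1 \<sigma> = point_simplex y"
    using g simplical_face_vertex(2) basis_in_standard_simplex[of 0 1]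
    by (auto simp: singular_face_def point_simplex_def standard_simplex_0 \<sigma>_def restrict_def pathstart_def)
  ultimately have "kboundary 1 (Poly_Mapping.single \<sigma> 1) = (point_chain x - point_chain y :: ('a, 'k) kchain)"
    by (simp add: kboundary_def point_chain_def single_uminus)
  moreover have "Poly_Mapping.single \<sigma> 1 \<in> (kchains 1 (top_of_set S) :: ('a, 'k) kchain set)"
    using \<sigma> by (simp add: kchains_def)
  ultimately show ?thesis
    using xy by (auto simp: khomologous_def point_chain_in_kcycles intro!: image_eqI)
qed

text \<open>The map in \<open>H0_incl_iso\<close> takes the image of a whole class. All members of
  the finer class of \<open>c\<close> are \<open>R\<close>-related to \<open>c\<close>, and
  \<open>c\<close> is one of them, so this image is the class of \<open>c\<close>: the induced map
  can be evaluated on representatives.\<close>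

lemma Image_refined_equiv_class:
  assumes "equiv B R" "Q \<subseteq> R" "(c, c) \<in> Q"
  shows "R `` (Q `` {c}) = R `` {c}"
  using assms by (auto dest: equivE elim!: equivE dest: transD symD)

text \<open>The point chains of \<open>x\<close> and \<open>y\<close> are homologous in
  \<open>T\<close>, so by injectivity in \<open>S\<close>. The coefficient sum over the component of
  \<open>x\<close> in \<open>S\<close> is 1 on the first, hence on the second, which places
  \<open>y\<close> in that component.\<close>

lemma H0_incl_iso_inj:
  assumes iso: "H0_incl_iso (k :: 'k::field itself) S T" and sub: "S \<subseteq> T"
    and x: "x \<in> S" and y: "y \<in> S" and xy: "path_component T x y"
  shows "path_component S x y"
proof -
  let ?RS = "khomologous 0 (top_of_set S) :: (('a, 'k) kchain \<times> ('a, 'k) kchain) set"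
  let ?RT = "khomologous 0 (top_of_set T) :: (('a, 'k) kchain \<times> ('a, 'k) kchain) set"
  have cyc: "point_chain z \<in> (kcycles 0 (top_of_set S) :: ('a, 'k) kchain set)" if "z \<in> S" for z
    using that by (simp add: point_chain_in_kcycles)
  have RT: "?RT `` (?RS `` {point_chain z}) = ?RT `` {point_chain z}" if "z \<in> S" for z
    using that by (intro Image_refined_equiv_class[OF equiv_khomologous khomologous_mono[OF sub]])
      (auto simp: khomologous_point_chain path_component_refl)
  have "?RT `` (?RS `` {point_chain x}) = ?RT `` (?RS `` {point_chain y})"
    unfolding RT[OF x] RT[OF y] using khomologous_point_chain[OF xy]
    by (rule equiv_class_eq[OF equiv_khomologous])
  moreover have "?RS `` {point_chain z} \<in> khomology 0 (top_of_set S)" if "z \<in> S" for z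
    using cyc[OF that] by (simp add: khomology_def quotientI)
  ultimately have "?RS `` {point_chain x} = ?RS `` {point_chain y}"
    using iso x y unfolding H0_incl_iso_def bij_betw_def by (meson inj_onD)
  then have "(point_chain x, point_chain y) \<in> ?RS"
    using eq_equiv_class[OF _ equiv_khomologous cyc[OF y]] by blast
  from coeff_sum_khomologous[OF this, of x] show ?thesis
    using x by (auto simp: coeff_sum_point_chain path_component_refl split: if_splits)
qed

text \<open>Surjectivity yields a cycle \<open>c\<close> of \<open>S\<close> that is homologous in
  \<open>T\<close> to the point chain of \<open>y\<close>. Its coefficient sum over the component of
  \<open>y\<close> is 1, so some simplex of \<open>c\<close> has its vertex in that component, and
  this vertex lies in \<open>S\<close>.\<close>

lemma H0_incl_iso_surj:
  assumes iso: "H0_incl_iso (k :: 'k::field itself) S T" and sub: "S \<subseteq> T" and y: "y \<in> T"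
  shows "\<exists>x\<in>S. path_component T x y"
proof -
  let ?RS = "khomologous 0 (top_of_set S) :: (('a, 'k) kchain \<times> ('a, 'k) kchain) set"
  let ?RT = "khomologous 0 (top_of_set T) :: (('a, 'k) kchain \<times> ('a, 'k) kchain) set"
  have cyc: "point_chain y \<in> (kcycles 0 (top_of_set T) :: ('a, 'k) kchain set)"
    using y by (simp add: point_chain_in_kcycles)
  then have "?RT `` {point_chain y} \<in> khomology 0 (top_of_set T)"
    by (simp add: khomology_def quotientI)
  then obtain z where z: "z \<in> khomology 0 (top_of_set S)" "?RT `` {point_chain y} = ?RT `` z"
    using iso unfolding H0_incl_iso_def bij_betw_def by blast
  then obtain c where c: "c \<in> kcycles 0 (top_of_set S)" "z = ?RS `` {c}"
    by (auto simp: khomology_def quotient_def)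
  have "(c, c) \<in> ?RS"
    using c equiv_khomologous by (meson equivE refl_onD)
  then have "?RT `` {point_chain y} = ?RT `` {c}"
    using z(2) unfolding c(2) by (simp add: Image_refined_equiv_class[OF equiv_khomologous khomologous_mono[OF sub]])
  moreover have "c \<in> kcycles 0 (top_of_set T)"
    using \<open>(c, c) \<in> ?RS\<close> khomologous_mono[OF sub] by (fastforce simp: khomologous_def)
  ultimately have "(point_chain y, c) \<in> ?RT"
    using eq_equiv_class[OF _ equiv_khomologous] by blast
  from coeff_sum_khomologous[OF this, of y] have "coeff_sum (path_component_set T y) c \<noteq> 0"
    using y by (simp add: coeff_sum_point_chain path_component_refl)
  moreover have "coeff_sum (path_component_set T y) c = 0"
    if "\<And>\<sigma>. \<sigma> \<in> Poly_Mapping.keys c \<Longrightarrow> \<sigma> vertex0 \<notin> path_component_set T y"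
    unfolding coeff_sum_def using that by (intro sum.neutral) simp
  ultimately obtain \<sigma> where \<sigma>: "\<sigma> \<in> Poly_Mapping.keys c" "\<sigma> vertex0 \<in> path_component_set T y"
    by blast
  have "singular_simplex 0 (top_of_set S) \<sigma>"
    using c \<sigma> by (auto simp: kcycles_0 kchains_def)
  then have "\<sigma> vertex0 \<in> S"
    by (auto simp: singular_simplex_subtopology standard_simplex_0)
  then show ?thesis
    using \<sigma>(2) by (auto intro: path_component_sym)
qed

section \<open>Reeb graphs and smoothings\<close>

lemma topspace_quotient_topology [simp]: "topspace (quotient_topology Y q) = q ` topspace Y"
proof -
  have "{y \<in> topspace Y. q y \<in> q ` topspace Y} = topspace Y"
    by auto
  then have "openin (quotient_topology Y q) (q ` topspace Y)"
    by (simp add: openin_quotient_topology)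
  moreover have "topspace (quotient_topology Y q) \<subseteq> q ` topspace Y"
    using openin_quotient_topology[of Y q "topspace (quotient_topology Y q)"] by simp
  ultimately show ?thesis
    by (auto dest: openin_subset)
qed

lemma quotient_map_quotient_topology: "quotient_map Y (quotient_topology Y q) q"
  by (simp add: quotient_map_def openin_quotient_topology)

lemma reeb_class_self: "y \<in> topspace (fst Y) \<Longrightarrow> y \<in> reeb_class Y y"
  by (simp add: reeb_class_def connected_component_of_refl)

lemma reeb_class_subset: "reeb_class Y y \<subseteq> topspace (fst Y) \<inter> {z. snd Y z = snd Y y}"
  unfolding reeb_class_def
  by (metis connected_component_of_subset_topspace topspace_subtopology)

lemma connectedin_reeb_class: "connectedin (fst Y) (reeb_class Y y)"
  unfolding reeb_class_def
  by (metis connectedin_connected_component_of connectedin_subtopology)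

text \<open>Identifications in Reeb graphs are obtained below in this way, by exhibiting a connected
  set inside one level.\<close>

lemma reeb_class_eqI:
  assumes "connectedin (fst Y) Z" "Z \<subseteq> {z. snd Y z = v}" "y \<in> Z" "y' \<in> Z"
  shows "reeb_class Y y = reeb_class Y y'"
proof -
  have v: "snd Y y = v" "snd Y y' = v"
    using assms by auto
  have "connectedin (subtopology (fst Y) {z. snd Y z = v}) Z"
    using assms by (simp add: connectedin_subtopology)
  then have "connected_component_of (subtopology (fst Y) {z. snd Y z = v}) y y'"
    using assms unfolding connected_component_of_def by blast
  then show ?thesis
    unfolding reeb_class_def v by (metis connected_component_of_equiv)
qed

lemma topspace_reeb_graph: "topspace (fst (reeb_graph Y)) = reeb_class Y ` topspace (fst Y)"
  by (simp add: reeb_graph_def)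

lemma quotient_map_reeb_class: "quotient_map (fst Y) (fst (reeb_graph Y)) (reeb_class Y)"
  by (simp add: reeb_graph_def quotient_map_quotient_topology)

lemma the_elem_image_const: "y \<in> C \<Longrightarrow> (\<And>z. z \<in> C \<Longrightarrow> g z = v) \<Longrightarrow> the_elem (g ` C) = v"
  by (metis (no_types, lifting) empty_iff image_cong image_constant_conv the_elem_eq)

lemma snd_reeb_graph: "y \<in> topspace (fst Y) \<Longrightarrow> snd (reeb_graph Y) (reeb_class Y y) = snd Y y"
  unfolding reeb_graph_def snd_conv
  by (rule the_elem_image_const[OF reeb_class_self]) (use reeb_class_subset[of Y y] in auto)

lemma rspace_map_reeb_class: "rspace_map Y (reeb_graph Y) (reeb_class Y)"
  by (simp add: rspace_map_def quotient_imp_continuous_map[OF quotient_map_reeb_class] snd_reeb_graph)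

lemma rspace_map_compose: "rspace_map Y Z \<alpha> \<Longrightarrow> rspace_map Z W \<beta> \<Longrightarrow> rspace_map Y W (\<beta> \<circ> \<alpha>)"
  using continuous_map_funspace[of "fst Y" "fst Z" \<alpha>]
  by (auto simp: rspace_map_def continuous_map_compose Pi_iff)

text \<open>Morphisms preserve connectedness and levels, so the image of a Reeb class lies in a
  single Reeb class; this makes the choice hidden in \<open>the_elem\<close> harmless.\<close>

lemma reeb_map_class:
  assumes \<alpha>: "rspace_map Y Z \<alpha>" and y: "y \<in> topspace (fst Y)"
  shows "reeb_map Z \<alpha> (reeb_class Y y) = reeb_class Z (\<alpha> y)"
  unfolding reeb_map_def
proof (rule the_elem_image_const[OF reeb_class_self[OF y]])
  fix z assume z: "z \<in> reeb_class Y y"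
  show "reeb_class Z (\<alpha> z) = reeb_class Z (\<alpha> y)"
  proof (rule reeb_class_eqI)
    show "connectedin (fst Z) (\<alpha> ` reeb_class Y y)"
      using \<alpha> unfolding rspace_map_def by (blast intro: connectedin_continuous_map_image connectedin_reeb_class)
    show "\<alpha> ` reeb_class Y y \<subseteq> {w. snd Z w = snd Y y}"
      using \<alpha> reeb_class_subset[of Y y] by (auto simp: rspace_map_def subset_iff)
  qed (use z reeb_class_self[OF y] in auto)
qed

section \<open>Thickenings and smoothings of morphisms\<close>

lemma topspace_thicken [simp]: "topspace (fst (thicken \<epsilon> Y)) = topspace (fst Y) \<times> {-\<epsilon>..\<epsilon>}"
  by (simp add: thicken_def)

lemma snd_thicken [simp]: "snd (thicken \<epsilon> Y) (y, t) = snd Y y + t"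
  by (simp add: thicken_def)

lemma rspace_map_thicken:
  assumes "rspace_map Y Z \<alpha>"
  shows "rspace_map (thicken \<epsilon> Y) (thicken \<epsilon> Z) (map_prod \<alpha> id)"
proof -
  have "continuous_map (prod_topology (fst Y) (top_of_set {-\<epsilon>..\<epsilon>})) (prod_topology (fst Z) (top_of_set {-\<epsilon>..\<epsilon>}))
      (\<lambda>(x, y). (\<alpha> x, id y))"
    using assms by (subst continuous_map_prod_top) (auto simp: rspace_map_def)
  then show ?thesis
    using assms by (auto simp: rspace_map_def thicken_def map_prod_def)
qed

lemma smoothing_map_class:
  assumes "rspace_map Y Z \<alpha>" "y \<in> topspace (fst Y)" "\<bar>t\<bar> \<le> \<epsilon>"
  shows "smoothing_map \<epsilon> Z \<alpha> (reeb_class (thicken \<epsilon> Y) (y, t)) = reeb_class (thicken \<epsilon> Z) (\<alpha> y, t)"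
  using reeb_map_class[OF rspace_map_thicken[OF assms(1)], of "(y, t)" \<epsilon>] assms
  by (simp add: smoothing_map_def abs_le_iff)

lemma rspace_map_zeta:
  assumes "0 \<le> \<epsilon>"
  shows "rspace_map Y (smoothing \<epsilon> Y) (zeta \<epsilon> Y)"
proof -
  have "rspace_map Y (thicken \<epsilon> Y) (\<lambda>y. (y, 0))"
    using assms by (auto simp: rspace_map_def thicken_def continuous_map_pairwise o_def)
  from rspace_map_compose[OF this rspace_map_reeb_class] show ?thesis
    by (simp add: smoothing_def zeta_def[abs_def] o_def)
qed

section \<open>Components over open intervals\<close>

lemma over_mono: "S \<subseteq> T \<Longrightarrow> V \<subseteq> W \<Longrightarrow> over f S V \<subseteq> over f T W"
  by (auto simp: over_def)

lemma mem_over [simp]: "y \<in> over f S V \<longleftrightarrow> y \<in> S \<and> f y \<in> V"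
  by (auto simp: over_def)

lemma openin_over:
  assumes "continuous_on X f" "open V"
  shows "openin (top_of_set X) (over f X V)"
  using continuous_openin_preimage_gen[OF assms] by (simp add: over_def Int_commute)

lemma locally_path_connected_over:
  assumes "locally path_connected X" "continuous_on X f" "open V"
  shows "locally path_connected (over f X V)"
  using locally_open_subset[OF assms(1) openin_over[OF assms(2,3)]] .

lemma openin_path_component_over:
  assumes "locally path_connected X" "continuous_on X f" "open V"
  shows "openin (top_of_set X) (path_component_set (over f X V) y)"
  using openin_path_component_locally_path_connected[OF locally_path_connected_over[OF assms]]
    openin_over[OF assms(2,3)] openin_trans by blast

text \<open>Open preimages inherit local path connectedness from \<open>X\<close>, so components and
  path components agree there. This converts the connected sets of Reeb graphs into the paths on
  which the mapper cosheaf is built.\<close>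

lemma path_component_over_connected:
  assumes "locally path_connected X" "continuous_on X f" "open V"
    and "connected Q" "Q \<subseteq> over f X V" "y \<in> Q" "y' \<in> Q"
  shows "path_component (over f X V) y y'"
  using path_component_eq_connected_component[OF locally_path_connected_over[OF assms(1-3)], of y] assms(4-)
  by (auto simp: connected_component_def)

lemma open_interval_subset:
  assumes "V \<in> open_intervals" "x \<in> V" "y \<in> V"
  shows "{x..y} \<subseteq> V"
  using assms by (auto simp: open_intervals_def intro: connectedD_interval)

text \<open>The segment over \<open>e\<close> between the levels \<open>s\<close> and
  \<open>t\<close> is a path in the stratum, and \<open>q\<close> is continuous on it. Its levels
  stay in \<open>W\<close> because \<open>W\<close> is an interval.\<close>

lemma constructible_stratum_path:
  assumes q: "quotient_map (strata_sum m a V E) (top_of_set X) q"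
    and level: "\<And>u. u \<in> topspace (strata_sum m a V E) \<Longrightarrow> f (q u) = snd (snd u)"
    and i: "i < m" and e: "e \<in> topspace (E i)" and st: "s \<in> {a i..a (Suc i)}" "t \<in> {a i..a (Suc i)}"
    and W: "connected W" "s \<in> W" "t \<in> W"
  shows "path_component (over f X W) (q (Inr i, e, s)) (q (Inr i, e, t))"
proof -
  let ?J = "{min s t..max s t}"
  let ?P = "prod_topology (E i) (top_of_set {a i..a (Suc i)})"
  let ?X = "case_sum (\<lambda>i. prod_topology (V i) (top_of_set {a i}))
      (\<lambda>i. prod_topology (E i) (top_of_set {a i..a (Suc i)}))"
  let ?g = "\<lambda>u. q (Inr i, e, u)"
  have J: "?J \<subseteq> {a i..a (Suc i)}"
    using st by auto
  have JW: "?J \<subseteq> W"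
  proof
    fix u assume "u \<in> ?J"
    moreover have "min s t \<in> W" "max s t \<in> W"
      using W by (simp_all add: min_def max_def)
    ultimately show "u \<in> W"
      using connectedD_interval[OF W(1), of "min s t" "max s t" u] by simp
  qed
  have top: "(Inr i, e, u) \<in> topspace (strata_sum m a V E)" if "u \<in> ?J" for u
    using that i e J by (auto simp: strata_sum_def)
  have "continuous_map (?X (Inr i)) (strata_sum m a V E) (\<lambda>x. (Inr i, x))"
    unfolding strata_sum_def using i by (intro continuous_map_component_injection) auto
  then have inj: "continuous_map ?P (strata_sum m a V E) (\<lambda>x. (Inr i, x))"
    by simp
  have "continuous_map (top_of_set ?J) ?P (\<lambda>u. (e, u))"
    using e J by (auto simp: continuous_map_pairwise o_def continuous_map_in_subtopology)
  then have "continuous_map (top_of_set ?J) (strata_sum m a V E) ((\<lambda>x. (Inr i, x)) \<circ> (\<lambda>u. (e, u)))"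
    using inj by (rule continuous_map_compose)
  then have "continuous_map (top_of_set ?J) (top_of_set X) (q \<circ> ((\<lambda>x. (Inr i, x)) \<circ> (\<lambda>u. (e, u))))"
    using quotient_imp_continuous_map[OF q] by (rule continuous_map_compose)
  then have g: "continuous_map (top_of_set ?J) (top_of_set X) ?g"
    by (simp add: o_def)
  then have "path_connected (?g ` ?J)"
    by (auto intro: path_connected_continuous_image)
  moreover have "?g ` ?J \<subseteq> over f X W"
    using g level[OF top] JW by fastforce
  moreover have "s \<in> ?J" "t \<in> ?J"
    by simp_all
  ultimately show ?thesis
    unfolding path_connected_component by (meson imageI path_component_of_subset)
qed

text \<open>
  Inside \<open>W\<close>, every point can be moved along a stratum \<open>{e} \<times> [a i, a (i + 1)]\<close> into
  the preimage of a compact interval, which meets only finitely many components.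
\<close>

lemma finite_pi0_over:
  fixes X :: "'a::metric_space set"
  assumes X: "compact X" "locally path_connected X" and f: "continuous_on X f"
    and constructible: "constructible (top_of_set X, f)" and W: "W \<in> open_intervals"
  shows "finite (pi0 (over f X W))"
proof -
  obtain m a and V E :: "nat \<Rightarrow> 'a topology" and q where a: "\<forall>i<m. a i < a (Suc i)"
    and q: "quotient_map (strata_sum m a V E) (top_of_set X) q"
    and level: "\<And>u. u \<in> topspace (strata_sum m a V E) \<Longrightarrow> f (q u) = snd (snd u)"
    using constructible unfolding constructible_def fst_conv snd_conv by (elim exE conjE) (rule that, assumption, assumption, simp)
  have W': "open W" "connected W" "W \<noteq> {}"
    using W by (auto simp: open_intervals_def)
  obtain w where w: "w \<in> W"
    using W' by auto
  \<comment> \<open>The critical levels inside \<open>W\<close>, together with some \<open>w\<close>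
    to make the set nonempty. No critical level of \<open>W\<close> lies outside the compact
    interval from \<open>Min A\<close> to \<open>Max A\<close>.\<close>
  define A where "A = insert w (a ` {..m} \<inter> W)"
  have A: "finite A" "A \<noteq> {}" "A \<subseteq> W"
    using w by (auto simp: A_def)
  let ?c = "Min A" and ?d = "Max A"
  have cd: "?c \<in> W" "?d \<in> W" "?c \<le> ?d"
    using A Min_in[OF A(1,2)] Max_in[OF A(1,2)] Min_le[OF A(1) Max_in[OF A(1,2)]] by (blast, blast, simp)
  have acd: "a i \<in> {?c..?d}" if "i \<le> m" "a i \<in> W" for i
  proof -
    have "a i \<in> A"
      using that by (auto simp: A_def)
    then show ?thesis
      using A by simp
  qed
  let ?K = "X \<inter> f -` {?c..?d}"
  have meet: "\<exists>z\<in>?K. path_component (over f X W) z y" if y: "y \<in> over f X W" for y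
  proof (cases "f y \<in> {?c..?d}")
    case True
    then show ?thesis
      using y by (auto intro!: bexI[of _ y] simp: path_component_refl)
  next
    case False
    obtain u where u: "u \<in> topspace (strata_sum m a V E)" "y = q u"
      using y quotient_imp_surjective_map[OF q] by fastforce
    have fy: "f y = snd (snd u)" "f y \<in> W"
      using u level y by auto
    have "fst u \<in> range Inr"
    proof (rule ccontr)
      assume "fst u \<notin> range Inr"
      then obtain i where "i \<le> m" "snd (snd u) = a i"
        using u(1) by (cases u; cases "fst u") (auto simp: strata_sum_def)
      with fy acd False show False
        by auto
    qed
    then obtain i e t where ue: "u = (Inr i, e, t)"
      by (cases u) auto
    then have iet: "i < m" "e \<in> topspace (E i)" "t \<in> {a i..a (Suc i)}" "t = f y"
      using u fy by (auto simp: strata_sum_def)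
    \<comment> \<open>The end of the compact interval that is closer to \<open>t\<close>. The
      stratum through \<open>y\<close> reaches it: otherwise it would stop at a critical level that
      lies in \<open>W\<close> but outside that interval.\<close>
    define s where "s = (if t < ?c then ?c else ?d)"
    have s: "s \<in> W" "s \<in> {?c..?d}"
      using cd by (auto simp: s_def)
    have "s \<in> {a i..a (Suc i)}"
    proof (cases "t < ?c")
      case True
      have "?c \<le> a (Suc i)"
      proof (rule ccontr)
        assume "\<not> ?c \<le> a (Suc i)"
        then have "a (Suc i) \<in> {t..?c}"
          using iet by auto
        then have "a (Suc i) \<in> W"
          using open_interval_subset[OF W _ cd(1), of t] fy iet by auto
        then show False
          using acd[of "Suc i"] iet \<open>\<not> ?c \<le> a (Suc i)\<close> by auto
      qed
      then show ?thesis
        using True iet by (auto simp: s_def)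
    next
      case t: False
      then have t: "t > ?d"
        using False iet by auto
      have "a i \<le> ?d"
      proof (rule ccontr)
        assume "\<not> a i \<le> ?d"
        then have "a i \<in> {?d..t}"
          using iet by auto
        then have "a i \<in> W"
          using open_interval_subset[OF W cd(2), of t] fy iet by auto
        then show False
          using acd[of i] iet \<open>\<not> a i \<le> ?d\<close> by auto
      qed
      then show ?thesis
        using t cd iet by (auto simp: s_def)
    qed
    moreover have "t \<in> W"
      using fy(2) iet(4) by simp
    ultimately have "path_component (over f X W) (q (Inr i, e, s)) (q (Inr i, e, t))"
      by (intro constructible_stratum_path[OF q _ iet(1,2) _ iet(3) W'(2) s(1)] level)
    then have *: "path_component (over f X W) (q (Inr i, e, s)) y"
      using u(2) ue by simp
    have "(Inr i, e, s) \<in> topspace (strata_sum m a V E)"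
      using iet(1,2) \<open>s \<in> {a i..a (Suc i)}\<close> by (auto simp: strata_sum_def)
    then have "f (q (Inr i, e, s)) = s"
      using level by fastforce
    then show ?thesis
      using * path_component_mem(1)[OF *] s by (auto intro!: bexI[of _ "q (Inr i, e, s)"])
  qed
  \<comment> \<open>The preimage of \<open>W\<close> need not be compact, but that of the closed
    interval is. The components over \<open>W\<close> are open in \<open>X\<close>, so finitely many
    of them cover it.\<close>
  have "compact ?K"
    using continuous_closedin_preimage[OF f closed_atLeastAtMost] closedin_compact[OF X(1)] by blast
  then have "compactin (top_of_set X) ?K"
    by (simp add: compactin_subtopology)
  moreover have "?K \<subseteq> over f X W"
    using open_interval_subset[OF W cd(1,2)] by auto
  then have "?K \<subseteq> \<Union> (path_component_set (over f X W) ` ?K)"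
    using path_component_refl[of _ "over f X W"] by blast
  moreover have "openin (top_of_set X) U" if "U \<in> path_component_set (over f X W) ` ?K" for U
    using that openin_path_component_over[OF X(2) f W'(1)] by auto
  ultimately have "\<exists>\<F>. finite \<F> \<and> \<F> \<subseteq> path_component_set (over f X W) ` ?K \<and> ?K \<subseteq> \<Union>\<F>"
    by (intro compactinD)
  then obtain \<F> where \<F>: "finite \<F>" "\<F> \<subseteq> path_component_set (over f X W) ` ?K" "?K \<subseteq> \<Union>\<F>"
    by blast
  obtain D where D': "D \<subseteq> ?K" "finite D" "\<F> = path_component_set (over f X W) ` D"
    using finite_subset_image[OF \<F>(1,2)] by blast
  then have D: "finite D" "?K \<subseteq> (\<Union>y\<in>D. path_component_set (over f X W) y)"
    using \<F>(3) by simp_all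
  have "pi0 (over f X W) \<subseteq> path_component_set (over f X W) ` D"
  proof
    fix C assume "C \<in> pi0 (over f X W)"
    then obtain y where y: "y \<in> over f X W" "C = path_component_set (over f X W) y"
      by (auto simp: pi0_def)
    then obtain z where z: "z \<in> ?K" "path_component (over f X W) z y"
      using meet by blast
    then obtain d where d: "d \<in> D" "path_component (over f X W) d z"
      using D(2) by blast
    then have "path_component_set (over f X W) d = C"
      unfolding y(2) using path_component_trans[OF d(2) z(2)] path_component_eq by (metis mem_Collect_eq)
    then show "C \<in> path_component_set (over f X W) ` D"
      using d(1) by blast
  qed
  then show ?thesis
    using D(1) finite_surj by blast
qed

section \<open>The display locale of the mapper cosheaf\<close>

lemma pi0_incl_path_component_set:
  assumes "A \<subseteq> B" "y \<in> A"
  shows "pi0_incl B (path_component_set A y) = path_component_set B y"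
proof -
  have "path_component_set B x = path_component_set B y" if "x \<in> path_component_set A y" for x
    using that path_component_of_subset[OF assms(1)] by (metis mem_Collect_eq path_component_eq)
  moreover have "y \<in> path_component_set A y"
    using assms by (simp add: path_component_refl)
  ultimately show ?thesis
    unfolding pi0_incl_def by blast
qed

section \<open>Smallest cover intersections and hulls\<close>

definition core :: "real set set \<Rightarrow> real \<Rightarrow> real set" where
  "core \<U> x = \<Inter>{V \<in> \<U>. x \<in> V}"

lemma core_self: "x \<in> core \<U> x"
  by (auto simp: core_def)

lemma core_subset: "y \<in> core \<U> x \<Longrightarrow> core \<U> y \<subseteq> core \<U> x"
  by (auto simp: core_def)

lemma cover_hull_eq_UN_core: "cover_hull \<U> U = (\<Union>x\<in>U. core \<U> x)"
  by (simp add: cover_hull_def core_def)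

lemma subset_cover_hull: "U \<subseteq> cover_hull \<U> U"
  using core_self by (auto simp: cover_hull_eq_UN_core)

lemma core_subset_cover_hull: "x \<in> U \<Longrightarrow> core \<U> x \<subseteq> cover_hull \<U> U"
  by (auto simp: cover_hull_eq_UN_core)

lemma cover_hull_mono: "U \<subseteq> W \<Longrightarrow> cover_hull \<U> U \<subseteq> cover_hull \<U> W"
  by (auto simp: cover_hull_eq_UN_core)

text \<open>For \<open>z\<close> in \<open>U\<close> the set \<open>core \<U> z\<close> is contained
  in \<open>core \<U> x\<close>, so in the union that forms the hull the term of \<open>x\<close>
  contains all others.\<close>

lemma cover_hull_small: "x \<in> U \<Longrightarrow> U \<subseteq> core \<U> x \<Longrightarrow> cover_hull \<U> U = core \<U> x"
  unfolding cover_hull_eq_UN_core using core_subset by blast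

lemma core_in_cover_inters:
  assumes "nice_cover \<U>"
  shows "core \<U> x \<in> cover_inters \<U>"
proof -
  have "x \<in> \<Union>\<U>"
    using assms by (simp add: nice_cover_def)
  then have "{V \<in> \<U>. x \<in> V} \<noteq> {}"
    by auto
  then show ?thesis
    unfolding core_def cover_inters_def by (intro CollectI exI conjI refl) auto
qed

lemma core_in_open_intervals:
  assumes "nice_cover \<U>"
  shows "core \<U> x \<in> open_intervals"
proof -
  have \<U>: "open V" "is_interval V" if "V \<in> \<U>" for V
    using assms that by (auto simp: nice_cover_def open_intervals_def is_interval_connected_1)
  have "finite {V \<in> \<U>. x \<in> V}"
    using assms by (auto simp: nice_cover_def)
  then have "open (core \<U> x)"
    unfolding core_def by (intro open_Inter) (auto intro: \<U>)
  moreover have "is_interval (core \<U> x)"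
    using \<U>(2) unfolding core_def is_interval_1 by blast
  ultimately show ?thesis
    using core_self[of x \<U>] by (auto simp: open_intervals_def is_interval_connected_1)
qed

lemma open_intervals_Int:
  assumes "I \<in> open_intervals" "J \<in> open_intervals" "I \<inter> J \<noteq> {}"
  shows "I \<inter> J \<in> open_intervals"
  using assms by (auto simp: open_intervals_def is_interval_Int simp flip: is_interval_connected_1)

section \<open>Neighbourhoods in the display locale\<close>

lemma open_interval_within:
  assumes "open W" "x \<in> W"
  obtains I where "I \<in> open_intervals" "x \<in> I" "I \<subseteq> W"
proof -
  obtain e where "0 < e" "ball x e \<subseteq> W"
    using assms openE by blast
  then show ?thesis
    by (intro that[of "ball x e"]) (auto simp: open_intervals_def)
qed

text \<open>The structure map computes the value of a costalk element on \<open>J\<close> from its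
  value on \<open>I\<close>, so agreement on \<open>I\<close> forces agreement on
  \<open>J\<close>.\<close>

lemma display_cell_mono:
  assumes "s \<in> costalk F \<phi> x" "x \<in> I" "I \<subseteq> J" "I \<in> open_intervals" "J \<in> open_intervals"
  shows "display_cell F \<phi> I (s I) \<subseteq> display_cell F \<phi> J (s J)"
proof -
  have *: "s' J = \<phi> I J (s' I)" if "s' \<in> costalk F \<phi> x'" "x' \<in> I" for s' x'
    using that assms unfolding costalk_def by force
  have "s' J = s J" if "s' \<in> costalk F \<phi> x'" "x' \<in> I" "s' I = s I" for s' x'
    using *[OF that(1,2)] *[OF assms(1,2)] that(3) by simp
  then show ?thesis
    using assms(3) by (auto simp: display_cell_def)
qed

lemma openin_display_cell:
  assumes "I \<in> open_intervals"
  shows "openin (fst (display_locale F \<phi>)) (display_cell F \<phi> I a)"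
proof (cases "a \<in> F I")
  case False
  then have "display_cell F \<phi> I a = {}"
    using assms by (auto simp: display_cell_def costalk_def)
  then show ?thesis
    by simp
next
  case True
  then show ?thesis
    using assms by (auto simp: display_locale_def intro: topology_generated_by_Basis)
qed

lemma topspace_display_locale:
  "topspace (fst (display_locale F \<phi>)) = {(x, s). s \<in> costalk F \<phi> x}"
proof -
  have "UNIV \<in> open_intervals"
    by (simp add: open_intervals_def)
  then have "(x, s) \<in> display_cell F \<phi> UNIV (s UNIV)" "s UNIV \<in> F UNIV" if "s \<in> costalk F \<phi> x" for x s
    using that by (auto simp: display_cell_def costalk_def)
  then show ?thesis
    using \<open>UNIV \<in> open_intervals\<close>
    unfolding display_locale_def fst_conv topology_generated_by_topspace
    by (auto simp: display_cell_def) blast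
qed

text \<open>By definition the cells are only a subbasis. Two cells around the same point both
  contain its cell over the intersection of their intervals, which makes them a neighbourhood basis
  there.\<close>

lemma display_locale_basis:
  assumes "openin (fst (display_locale F \<phi>)) W" "(x, s) \<in> W"
  shows "\<exists>I\<in>open_intervals. x \<in> I \<and> display_cell F \<phi> I (s I) \<subseteq> W"
proof -
  have s: "s \<in> costalk F \<phi> x"
    using openin_subset[OF assms(1)] assms(2) by (auto simp: topspace_display_locale)
  have "generate_topology_on {display_cell F \<phi> I a | I a. I \<in> open_intervals \<and> a \<in> F I} W"
    using assms(1) by (simp add: display_locale_def openin_topology_generated_by_iff)
  then show ?thesis
    using assms(2)
  proof (induction W)
    case (Int V W)
    then obtain I J where IJ: "I \<in> open_intervals" "x \<in> I" "display_cell F \<phi> I (s I) \<subseteq> V"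
      "J \<in> open_intervals" "x \<in> J" "display_cell F \<phi> J (s J) \<subseteq> W"
      by auto
    have "I \<inter> J \<in> open_intervals"
      using IJ open_intervals_Int by blast
    then show ?case
      using IJ display_cell_mono[OF s, of "I \<inter> J" I] display_cell_mono[OF s, of "I \<inter> J" J]
      by (intro bexI[of _ "I \<inter> J"]) auto
  next
    case (UN \<K>)
    then show ?case
      by (meson Union_iff Union_upper order_trans)
  next
    case (Basis C)
    then show ?case
      by (auto simp: display_cell_def)
  qed auto
qed

lemma continuous_map_display_fst: "continuous_map (fst (display_locale F \<phi>)) euclideanreal fst"
proof (clarsimp simp: continuous_map_def)
  fix W :: "real set"
  assume W: "open W"
  show "openin (fst (display_locale F \<phi>)) {u \<in> topspace (fst (display_locale F \<phi>)). fst u \<in> W}"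
  proof (subst openin_subopen, intro ballI)
    fix u assume "u \<in> {u \<in> topspace (fst (display_locale F \<phi>)). fst u \<in> W}"
    then obtain x s where u: "u = (x, s)" "s \<in> costalk F \<phi> x" "x \<in> W"
      by (auto simp: topspace_display_locale)
    obtain I where I: "I \<in> open_intervals" "x \<in> I" "I \<subseteq> W"
      using open_interval_within[OF W u(3)] .
    then show "\<exists>T. openin (fst (display_locale F \<phi>)) T \<and> u \<in> T \<and>
        T \<subseteq> {u \<in> topspace (fst (display_locale F \<phi>)). fst u \<in> W}"
      using u openin_display_cell[OF I(1)]
      by (intro exI[of _ "display_cell F \<phi> I (s I)"])
        (auto simp: display_cell_def topspace_display_locale)
  qed
qed

section \<open>Germs of points\<close>

text \<open>The deterministic content of the statistical hypotheses for one outcome: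
  \<open>S\<close> and \<open>T\<close> stand for the estimated sets at the upper and the lower
  level. \<open>path_X\<close> keeps components of \<open>X\<close> apart in \<open>T\<close>;
  \<open>near_X\<close> and \<open>near_S\<close> make \<open>S\<close> and \<open>X\<close> meet
  the same components of \<open>T\<close>. All this is imposed over the sets
  \<open>core \<U> x\<close>, where homology is controlled.\<close>

locale mapper_space =
  fixes X :: "'a::euclidean_space set" and f :: "'a \<Rightarrow> real" and \<U> :: "real set set" and S T :: "'a set"
  assumes compact: "compact X" and lpc: "locally path_connected X" and f: "continuous_on UNIV f"
    and cover: "nice_cover \<U>" and X_subset: "X \<subseteq> T" and S_subset: "S \<subseteq> T"
    and path_X: "\<And>x y y'. y \<in> over f X (core \<U> x) \<Longrightarrow> y' \<in> over f X (core \<U> x) \<Longrightarrow>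
      path_component (over f T (core \<U> x)) y y' \<Longrightarrow> path_component (over f X (core \<U> x)) y y'"
    and near_X: "\<And>x s. s \<in> over f S (core \<U> x) \<Longrightarrow>
      \<exists>y\<in>over f X (core \<U> x). path_component (over f T (core \<U> x)) y s"
    and near_S: "\<And>x y. y \<in> over f X (core \<U> x) \<Longrightarrow>
      \<exists>s\<in>over f S (core \<U> x). path_component (over f T (core \<U> x)) s y"
begin

abbreviation F :: "real set \<Rightarrow> 'a set set" where
  "F \<equiv> mapper_cosheaf f \<U> S T"

abbreviation \<phi> :: "real set \<Rightarrow> real set \<Rightarrow> 'a set \<Rightarrow> 'a set" where
  "\<phi> \<equiv> mapper_cosheaf_map f \<U> T"

abbreviation D :: "(real \<times> (real set \<Rightarrow> 'a set)) rspace" where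
  "D \<equiv> display_locale F \<phi>"

text \<open>For \<open>y\<close> outside the preimage the value is the empty set, not a component,
  which is why \<open>pcomp_eqD\<close> asks for membership.\<close>

definition pcomp :: "real set \<Rightarrow> 'a \<Rightarrow> 'a set" where
  "pcomp I y = path_component_set (over f T (cover_hull \<U> I)) y"

text \<open>Used for \<open>y\<close> over \<open>core \<U> x\<close>, not necessarily over
  \<open>x\<close> itself: the level \<open>x\<close> may miss the component of \<open>y\<close>
  altogether. Hence the shift by \<open>x - f y\<close> on the way to the Reeb graph.\<close>

definition germ :: "real \<Rightarrow> 'a \<Rightarrow> real set \<Rightarrow> 'a set" where
  "germ x y = (\<lambda>I \<in> {I \<in> open_intervals. x \<in> I}. pcomp I y)"

lemma f_X: "continuous_on X f"
  using f continuous_on_subset by blast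

lemma core_interval: "core \<U> x \<in> open_intervals"
  by (rule core_in_open_intervals[OF cover])

lemma open_core: "open (core \<U> x)"
  using core_interval by (auto simp: open_intervals_def)

lemma mem_F: "a \<in> F I \<longleftrightarrow> (\<exists>s\<in>over f S (cover_hull \<U> I). a = pcomp I s)"
proof -
  have "over f S (cover_hull \<U> I) \<subseteq> over f T (cover_hull \<U> I)"
    by (intro over_mono S_subset order_refl)
  then have "F I = pcomp I ` over f S (cover_hull \<U> I)"
    unfolding mapper_cosheaf_def pi0_def image_image pcomp_def
    by (intro image_cong refl pi0_incl_path_component_set)
  then show ?thesis
    by blast
qed

lemma pcomp_eqI: "path_component (over f T (cover_hull \<U> I)) y y' \<Longrightarrow> pcomp I y = pcomp I y'"
  unfolding pcomp_def by (metis mem_Collect_eq path_component_eq)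

lemma pcomp_eqD:
  assumes "pcomp I y = pcomp I y'" "y' \<in> over f T (cover_hull \<U> I)"
  shows "path_component (over f T (cover_hull \<U> I)) y y'"
  using assms unfolding pcomp_def by (metis mem_Collect_eq path_component_refl)

lemma \<phi>_pcomp:
  assumes "y \<in> over f T (cover_hull \<U> I)" "I \<subseteq> J"
  shows "\<phi> I J (pcomp I y) = pcomp J y"
  unfolding mapper_cosheaf_map_def pcomp_def
  using assms by (intro pi0_incl_path_component_set over_mono cover_hull_mono) auto

lemma over_core_subset: "x \<in> I \<Longrightarrow> over f S' (core \<U> x) \<subseteq> over f S' (cover_hull \<U> I)"
  by (intro over_mono core_subset_cover_hull order_refl)

lemma X_core_in_T: "x \<in> I \<Longrightarrow> y \<in> over f X (core \<U> x) \<Longrightarrow> y \<in> over f T (cover_hull \<U> I)"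
  using core_subset_cover_hull[of x I \<U>] X_subset by auto

text \<open>The values of the cosheaf come from \<open>S\<close>, and \<open>X\<close> need not be
  contained in \<open>S\<close>; \<open>near_S\<close> supplies a point of \<open>S\<close> in the
  same component of \<open>T\<close>.\<close>

lemma pcomp_in_F:
  assumes "x \<in> I" "y \<in> over f X (core \<U> x)"
  shows "pcomp I y \<in> F I"
proof -
  obtain s where s: "s \<in> over f S (core \<U> x)" "path_component (over f T (core \<U> x)) s y"
    using near_S[OF assms(2)] by blast
  then have "pcomp I y = pcomp I s"
    using pcomp_eqI path_component_of_subset[OF over_core_subset[OF assms(1)]] path_component_sym by metis
  then show ?thesis
    using s(1) over_core_subset[OF assms(1)] by (auto simp: mem_F simp del: mem_over)
qed

lemma F_small:
  assumes "x \<in> I" "I \<subseteq> core \<U> x" "a \<in> F I"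
  shows "\<exists>y\<in>over f X (core \<U> x). a = pcomp I y"
proof -
  have hull: "cover_hull \<U> I = core \<U> x"
    by (rule cover_hull_small[OF assms(1,2)])
  obtain s where s: "s \<in> over f S (core \<U> x)" "a = pcomp I s"
    using assms(3) unfolding mem_F hull by blast
  obtain y where y: "y \<in> over f X (core \<U> x)" "path_component (over f T (core \<U> x)) y s"
    using near_X[OF s(1)] by blast
  show ?thesis
    using s y pcomp_eqI[of I y s] unfolding hull by metis
qed

text \<open>For every such \<open>I\<close> the hull is \<open>core \<U> x\<close>. Together with
  \<open>F_small\<close> this identifies the value at \<open>I\<close> with the components of
  \<open>X\<close> over the core, whatever the size of \<open>I\<close>.\<close>

lemma pcomp_small_eq_iff:
  assumes "x \<in> I" "I \<subseteq> core \<U> x" "y \<in> over f X (core \<U> x)" "y' \<in> over f X (core \<U> x)"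
  shows "pcomp I y = pcomp I y' \<longleftrightarrow> path_component (over f X (core \<U> x)) y y'"
proof -
  have hull: "cover_hull \<U> I = core \<U> x"
    by (rule cover_hull_small[OF assms(1,2)])
  have "over f X (core \<U> x) \<subseteq> over f T (core \<U> x)"
    by (intro over_mono X_subset order_refl)
  then show ?thesis
    using pcomp_eqI[of I y y'] pcomp_eqD[of I y y'] path_X[OF assms(3,4)] X_core_in_T[OF assms(1,4)]
      path_component_of_subset unfolding hull by metis
qed

lemma germ_in_costalk:
  assumes y: "y \<in> over f X (core \<U> x)"
  shows "germ x y \<in> costalk F \<phi> x"
  unfolding costalk_def
proof (intro CollectI conjI ballI impI)
  show "germ x y \<in> (\<Pi>\<^sub>E I\<in>{I \<in> open_intervals. x \<in> I}. F I)"
    using pcomp_in_F y by (auto simp: germ_def simp del: mem_over)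
  fix I J assume "I \<in> open_intervals" "J \<in> open_intervals" "x \<in> I" "I \<subseteq> J"
  then show "\<phi> I J (germ x y I) = germ x y J"
    using \<phi>_pcomp[OF X_core_in_T[OF _ y]] by (auto simp: germ_def)
qed

text \<open>The point \<open>y\<close> is read off at \<open>core \<U> x\<close>. The value on
  another \<open>I\<close> is found on the intersection of \<open>I\<close> with the core: there an
  element is determined by its image over the core, and the structure map then carries it to
  \<open>I\<close>.\<close>

lemma costalk_germ:
  assumes s: "s \<in> costalk F \<phi> x"
  obtains y where "y \<in> over f X (core \<U> x)" "s = germ x y"
proof -
  let ?C = "core \<U> x"
  have res: "\<phi> I J (s I) = s J" if "I \<in> open_intervals" "J \<in> open_intervals" "x \<in> I" "I \<subseteq> J" for I J
    using s that by (auto simp: costalk_def)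
  have mem: "s I \<in> F I" if "I \<in> open_intervals" "x \<in> I" for I
    using s that by (auto simp: costalk_def)
  obtain y where y: "y \<in> over f X ?C" "s ?C = pcomp ?C y"
    using F_small[OF core_self _ mem[OF core_interval core_self]] by auto
  have "s I = pcomp I y" if I: "I \<in> open_intervals" "x \<in> I" for I
  proof -
    let ?J = "I \<inter> ?C"
    have J: "?J \<in> open_intervals" "x \<in> ?J" "?J \<subseteq> ?C"
      using open_intervals_Int[OF I(1) core_interval[of x]] I core_self[of x \<U>] by auto
    obtain z where z: "z \<in> over f X ?C" "s ?J = pcomp ?J z"
      using F_small[OF J(2,3) mem[OF J(1,2)]] by blast
    have "pcomp ?C z = pcomp ?C y"
      using res[OF J(1) core_interval J(2,3)] \<phi>_pcomp[OF X_core_in_T[OF J(2) z(1)] J(3)] z y by simp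
    then have "pcomp ?J z = pcomp ?J y"
      using pcomp_small_eq_iff[OF J(2,3) z(1) y(1)] pcomp_small_eq_iff[OF core_self order_refl z(1) y(1)] by simp
    then show ?thesis
      using res[OF J(1) I(1) J(2)] \<phi>_pcomp[OF X_core_in_T[OF J(2) y(1)], of I] z by simp
  qed
  moreover have "s \<in> extensional {I \<in> open_intervals. x \<in> I}"
    using s by (auto simp: costalk_def PiE_def)
  ultimately have "s = germ x y"
    by (auto simp: germ_def fun_eq_iff extensional_def restrict_def)
  then show thesis
    using that y by blast
qed

lemma topspace_D: "topspace (fst D) = {(x, germ x y) | x y. y \<in> over f X (core \<U> x)}"
  unfolding topspace_display_locale using germ_in_costalk by (blast elim: costalk_germ)

lemma germ_in_cell:
  assumes "y \<in> over f X (core \<U> x)" "I \<in> open_intervals"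
  shows "(x, germ x y) \<in> display_cell F \<phi> I a \<longleftrightarrow> x \<in> I \<and> pcomp I y = a"
  using assms germ_in_costalk by (auto simp: display_cell_def germ_def)

lemma germ_eq_iff:
  assumes "y \<in> over f X (core \<U> x)" "y' \<in> over f X (core \<U> x)"
  shows "germ x y = germ x y' \<longleftrightarrow> path_component (over f X (core \<U> x)) y y'"
proof
  assume "germ x y = germ x y'"
  then have "germ x y (core \<U> x) = germ x y' (core \<U> x)"
    by simp
  then have "pcomp (core \<U> x) y = pcomp (core \<U> x) y'"
    using core_interval core_self by (simp add: germ_def)
  then show "path_component (over f X (core \<U> x)) y y'"
    using pcomp_small_eq_iff[OF core_self order_refl assms] by simp
next
  assume *: "path_component (over f X (core \<U> x)) y y'"
  have "pcomp I y = pcomp I y'" if "x \<in> I" for I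
  proof (rule pcomp_eqI, rule path_component_of_subset[OF _ *])
    show "over f X (core \<U> x) \<subseteq> over f T (cover_hull \<U> I)"
      using X_core_in_T[OF that] by blast
  qed
  then show "germ x y = germ x y'"
    unfolding germ_def by (intro restrict_ext) auto
qed

text \<open>For \<open>z\<close> in \<open>I\<close> the set \<open>core \<U> z\<close> lies inside
  \<open>core \<U> x\<close>, so a representative of a germ at \<open>z\<close> is also a point over
  \<open>core \<U> x\<close>, where its component can be compared with that of
  \<open>y\<close>.\<close>

lemma small_cell:
  assumes "x \<in> I" "I \<subseteq> core \<U> x" "I \<in> open_intervals" "y \<in> over f X (core \<U> x)"
    and "u \<in> display_cell F \<phi> I (pcomp I y)"
  obtains z w where "u = (z, germ z w)" "z \<in> I" "w \<in> over f X (core \<U> z)" "w \<in> over f X (core \<U> x)"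
    "path_component (over f X (core \<U> x)) y w"
proof -
  obtain z s where u: "u = (z, s)" "s \<in> costalk F \<phi> z" "z \<in> I"
    using assms by (auto simp: display_cell_def)
  obtain w where w: "w \<in> over f X (core \<U> z)" "s = germ z w"
    using costalk_germ[OF u(2)] .
  have w': "w \<in> over f X (core \<U> x)"
    using w(1) core_subset[of z \<U> x] u(3) assms(2) by auto
  have "pcomp I w = pcomp I y"
    using assms(5) germ_in_cell[OF w(1) assms(3)] u w by auto
  then have "path_component (over f X (core \<U> x)) y w"
    using pcomp_small_eq_iff[OF assms(1,2,4) w'] by simp
  then show thesis
    using that u w w' by blast
qed

text \<open>All smaller intervals are included in the conclusion, so that a radius can later be
  shrunk to suit several components.\<close>

lemma small_cell_within:
  assumes W: "openin (fst D) W" "(x, germ x y) \<in> W" and y: "y \<in> over f X (core \<U> x)"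
  obtains I where "I \<in> open_intervals" "x \<in> I" "I \<subseteq> core \<U> x"
    "\<And>J. J \<in> open_intervals \<Longrightarrow> x \<in> J \<Longrightarrow> J \<subseteq> I \<Longrightarrow> display_cell F \<phi> J (pcomp J y) \<subseteq> W"
proof -
  obtain I where I: "I \<in> open_intervals" "x \<in> I" "display_cell F \<phi> I (germ x y I) \<subseteq> W"
    using display_locale_basis[OF W] by blast
  show thesis
  proof (rule that[of "I \<inter> core \<U> x"])
    show "I \<inter> core \<U> x \<in> open_intervals"
      using open_intervals_Int[OF I(1) core_interval[of x]] I core_self[of x \<U>] by auto
    fix J assume J: "J \<in> open_intervals" "x \<in> J" "J \<subseteq> I \<inter> core \<U> x"
    then have "display_cell F \<phi> J (germ x y J) \<subseteq> display_cell F \<phi> I (germ x y I)"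
      using display_cell_mono[OF germ_in_costalk[OF y]] I by auto
    then show "display_cell F \<phi> J (pcomp J y) \<subseteq> W"
      using I J by (auto simp: germ_def)
  qed (use I core_self in auto)
qed

lemma over_core_f: "y \<in> X \<Longrightarrow> y \<in> over f X (core \<U> (f y))"
  by (simp add: core_self)

text \<open>Moving along a path over \<open>I\<close> does not change the value at \<open>I\<close>,
  so the path component of \<open>y\<close> over \<open>I\<close> is mapped into one cell; it is
  open by local path connectedness.\<close>

lemma continuous_map_germ: "continuous_map (top_of_set X) (fst D) (\<lambda>y. (f y, germ (f y) y))"
  unfolding continuous_map_def
proof (intro conjI allI impI)
  show "(\<lambda>y. (f y, germ (f y) y)) \<in> topspace (top_of_set X) \<rightarrow> topspace (fst D)"
    unfolding topspace_D using over_core_f by auto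
  fix W assume W: "openin (fst D) W"
  show "openin (top_of_set X) {y \<in> topspace (top_of_set X). (f y, germ (f y) y) \<in> W}"
  proof (subst openin_subopen, intro ballI)
    fix y assume "y \<in> {y \<in> topspace (top_of_set X). (f y, germ (f y) y) \<in> W}"
    then have y: "y \<in> X" "(f y, germ (f y) y) \<in> W"
      by auto
    obtain I where I: "I \<in> open_intervals" "f y \<in> I"
      and "\<And>J. J \<in> open_intervals \<Longrightarrow> f y \<in> J \<Longrightarrow> J \<subseteq> I \<Longrightarrow> display_cell F \<phi> J (pcomp J y) \<subseteq> W"
      using small_cell_within[OF W y(2) over_core_f[OF y(1)]] by metis
    then have cell: "display_cell F \<phi> I (pcomp I y) \<subseteq> W"
      by blast
    let ?P = "path_component_set (over f X I) y"
    have P: "openin (top_of_set X) ?P"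
      using I by (intro openin_path_component_over lpc f_X) (auto simp: open_intervals_def)
    have "(f z, germ (f z) z) \<in> W" if z: "z \<in> ?P" for z
    proof -
      have zX: "z \<in> X" "f z \<in> I"
        using z path_component_subset[of "over f X I" y] by auto
      have "path_component (over f T (cover_hull \<U> I)) y z"
        using path_component_of_subset[OF over_mono[OF X_subset subset_cover_hull]] z by simp
      then have "pcomp I z = pcomp I y"
        using pcomp_eqI by metis
      then have "(f z, germ (f z) z) \<in> display_cell F \<phi> I (pcomp I y)"
        using germ_in_cell[OF over_core_f[OF zX(1)] I(1)] zX by auto
      then show ?thesis
        using cell by blast
    qed
    moreover have "y \<in> ?P"
      using y I by (simp add: path_component_refl)
    ultimately show "\<exists>U. openin (top_of_set X) U \<and> y \<in> U \<and>
        U \<subseteq> {y \<in> topspace (top_of_set X). (f y, germ (f y) y) \<in> W}"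
      using P path_component_subset[of "over f X I" y] by (intro exI[of _ ?P]) auto
  qed
qed

end

section \<open>Connectedness of the cells\<close>

lemma cosheaf_cover:
  assumes "cosheaf F \<phi>" "I \<in> open_intervals" "\<V> \<subseteq> open_intervals" "\<Union>\<V> = I"
  shows "a \<in> F I \<Longrightarrow> \<exists>J\<in>\<V>. \<exists>b\<in>F J. \<phi> J I b = a"
    and "J \<in> \<V> \<Longrightarrow> J' \<in> \<V> \<Longrightarrow> b \<in> F J \<Longrightarrow> b' \<in> F J' \<Longrightarrow>
      \<phi> J I b = \<phi> J' I b' \<longleftrightarrow> equivclp (overlap F \<phi> \<V>) (J, b) (J', b')"
proof -
  note * = assms(1)[unfolded cosheaf_def, THEN conjunct2, THEN bspec, OF assms(2), THEN spec, THEN mp,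
      OF conjI, OF assms(3,4)]
  show "a \<in> F I \<Longrightarrow> \<exists>J\<in>\<V>. \<exists>b\<in>F J. \<phi> J I b = a"
    by (rule *[THEN conjunct1, THEN bspec])
  show "J \<in> \<V> \<Longrightarrow> J' \<in> \<V> \<Longrightarrow> b \<in> F J \<Longrightarrow> b' \<in> F J' \<Longrightarrow>
      \<phi> J I b = \<phi> J' I b' \<longleftrightarrow> equivclp (overlap F \<phi> \<V>) (J, b) (J', b')"
    by (rule *[THEN conjunct2, THEN bspec, THEN bspec, THEN bspec, THEN bspec])
qed

lemma overlap_sym: "overlap F \<phi> \<V> u v \<Longrightarrow> overlap F \<phi> \<V> v u"
  by (erule overlap.cases) (metis Int_commute overlap.intros)

lemma display_cell_subset:
  assumes "J \<in> open_intervals" "J' \<in> open_intervals" "J \<subseteq> J'"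
  shows "display_cell F \<phi> J c \<subseteq> display_cell F \<phi> J' (\<phi> J J' c)"
proof clarify
  fix x s assume u: "(x, s) \<in> display_cell F \<phi> J c"
  then have "\<phi> J J' (s J) = s J'"
    using assms by (auto simp: display_cell_def costalk_def)
  then show "(x, s) \<in> display_cell F \<phi> J' (\<phi> J J' c)"
    using u assms by (auto simp: display_cell_def)
qed

context mapper_space
begin

lemma \<phi>_in_F:
  assumes "b \<in> F I" "I \<subseteq> J"
  shows "\<phi> I J b \<in> F J"
proof -
  obtain s where s: "s \<in> over f S (cover_hull \<U> I)" "b = pcomp I s"
    using assms(1) mem_F by blast
  have "s \<in> over f T (cover_hull \<U> I)" "s \<in> over f S (cover_hull \<U> J)"
    using s(1) S_subset cover_hull_mono[OF assms(2)] by auto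
  then show ?thesis
    unfolding mem_F s(2) using \<phi>_pcomp[OF _ assms(2)] by (intro bexI[of _ s])
qed

lemma \<phi>_\<phi>:
  assumes "b \<in> F I" "I \<subseteq> J" "J \<subseteq> K"
  shows "\<phi> J K (\<phi> I J b) = \<phi> I K b"
proof -
  obtain s where s: "s \<in> over f S (cover_hull \<U> I)" "b = pcomp I s"
    using assms(1) mem_F by blast
  have "s \<in> over f T (cover_hull \<U> I)" "s \<in> over f T (cover_hull \<U> J)"
    using s(1) S_subset cover_hull_mono[OF assms(2)] by auto
  then show ?thesis
    using assms(2,3) by (simp add: s(2) \<phi>_pcomp)
qed

lemma eventually_small_cell:
  assumes W: "openin (fst D) W" "(x, germ x y) \<in> W" and y: "y \<in> over f X (core \<U> x)"
  shows "\<forall>\<^sub>F e in at_right 0. display_cell F \<phi> (ball x e) (pcomp (ball x e) y) \<subseteq> W"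
proof -
  obtain I where I: "I \<in> open_intervals" "x \<in> I"
    and cell: "\<And>J. J \<in> open_intervals \<Longrightarrow> x \<in> J \<Longrightarrow> J \<subseteq> I \<Longrightarrow> display_cell F \<phi> J (pcomp J y) \<subseteq> W"
    using small_cell_within[OF W y] by metis
  obtain e where e: "0 < e" "ball x e \<subseteq> I"
    using I openE unfolding open_intervals_def by blast
  have "display_cell F \<phi> (ball x d) (pcomp (ball x d) y) \<subseteq> W" if "0 < d" "d < e" for d
  proof (rule cell)
    show "ball x d \<in> open_intervals" "x \<in> ball x d"
      using that by (simp_all add: open_intervals_def)
    have "ball x d \<subseteq> ball x e"
      using that by (intro subset_ball) simp
    then show "ball x d \<subseteq> I"
      using e by simp
  qed
  then show ?thesis
    unfolding eventually_at_right_field using e(1) by blast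
qed

text \<open>The condition depends on \<open>y\<close> only through its component over
  \<open>core \<U> x\<close>, so it suffices to treat one representative of each of the finitely
  many components.\<close>

lemma uniform_small_cell:
  assumes fin: "finite (pi0 (over f X (core \<U> x)))"
    and W: "openin (fst D) W" and I: "I \<in> open_intervals" "x \<in> I"
  shows "\<forall>\<^sub>F e in at_right 0. \<forall>y\<in>over f X (core \<U> x).
    (x, germ x y) \<in> W \<longrightarrow> display_cell F \<phi> (ball x e) (pcomp (ball x e) y) \<subseteq> W"
proof -
  have "pi0 (over f X (core \<U> x)) \<subseteq> path_component_set (over f X (core \<U> x)) ` over f X (core \<U> x)"
    by (simp add: pi0_def)
  from finite_subset_image[OF fin this] obtain R where R: "R \<subseteq> over f X (core \<U> x)" "finite R"
    "pi0 (over f X (core \<U> x)) = path_component_set (over f X (core \<U> x)) ` R"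
    by blast
  have rep: "\<exists>r\<in>R. path_component (over f X (core \<U> x)) y r" if "y \<in> over f X (core \<U> x)" for y
  proof -
    have "path_component_set (over f X (core \<U> x)) y \<in> pi0 (over f X (core \<U> x))"
      using that unfolding pi0_def by (rule imageI)
    then obtain r where r: "r \<in> R" "path_component_set (over f X (core \<U> x)) y = path_component_set (over f X (core \<U> x)) r"
      unfolding R(3) by (rule imageE)
    moreover have "r \<in> path_component_set (over f X (core \<U> x)) r"
      using r(1) R(1) by (auto simp: path_component_refl)
    ultimately show ?thesis
      by auto
  qed
  have "\<forall>\<^sub>F e in at_right 0. \<forall>r\<in>R. (x, germ x r) \<in> W \<longrightarrow>
      display_cell F \<phi> (ball x e) (pcomp (ball x e) r) \<subseteq> W"
  proof (intro eventually_ball_finite R(2) ballI)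
    fix r assume "r \<in> R"
    then show "\<forall>\<^sub>F e in at_right 0. (x, germ x r) \<in> W \<longrightarrow>
        display_cell F \<phi> (ball x e) (pcomp (ball x e) r) \<subseteq> W"
      using eventually_small_cell[OF W] R(1) by (cases "(x, germ x r) \<in> W") auto
  qed
  moreover have "\<forall>\<^sub>F e in at_right 0. 0 < (e :: real)"
    by (simp add: eventually_at_right_less)
  moreover obtain e0 where e0: "0 < e0" "ball x e0 \<subseteq> core \<U> x"
    using open_core core_self openE by blast
  then have "\<forall>\<^sub>F e in at_right 0. e < e0"
    by (auto simp: eventually_at_right_field)
  ultimately show ?thesis
  proof eventually_elim
    case (elim e)
    have e: "x \<in> ball x e" "ball x e \<subseteq> core \<U> x"
      using elim e0 subset_ball[of e e0 x] by auto
    show ?case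
    proof (intro ballI impI)
      fix y assume y: "y \<in> over f X (core \<U> x)" "(x, germ x y) \<in> W"
      obtain r where r: "r \<in> R" "path_component (over f X (core \<U> x)) y r"
        using rep[OF y(1)] by blast
      have r': "r \<in> over f X (core \<U> x)"
        using r(1) R(1) by blast
      show "display_cell F \<phi> (ball x e) (pcomp (ball x e) y) \<subseteq> W"
        using elim(1) r y germ_eq_iff[OF y(1) r'] pcomp_small_eq_iff[OF e y(1) r'] by auto
    qed
  qed
qed

text \<open>The surjective half of the cosheaf condition, for the cover of \<open>I\<close> by its
  intersections with the cores: \<open>a\<close> comes from an element over a small interval, and
  that element is represented by a point of \<open>X\<close>, whose germ lies in the cell.\<close>

lemma display_cell_nonempty:
  assumes cosheaf: "cosheaf F \<phi>" and I: "I \<in> open_intervals" and a: "a \<in> F I"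
  shows "display_cell F \<phi> I a \<noteq> {}"
proof -
  let ?\<V> = "(\<lambda>z. I \<inter> core \<U> z) ` I"
  have \<V>: "?\<V> \<subseteq> open_intervals"
    using open_intervals_Int[OF I core_interval] core_self by blast
  moreover have "\<Union>?\<V> = I"
    using core_self by blast
  ultimately obtain J b where J: "J \<in> ?\<V>" "b \<in> F J" "\<phi> J I b = a"
    using cosheaf_cover(1)[OF cosheaf I _ _ a, of ?\<V>] by blast
  then obtain z where z: "z \<in> I" "J = I \<inter> core \<U> z"
    by blast
  obtain y where y: "y \<in> over f X (core \<U> z)" "b = pcomp J y"
    using F_small[of z J b] z J(2) core_self by auto
  have "\<phi> J I b = pcomp I y"
    unfolding y(2) using \<phi>_pcomp[OF X_core_in_T[OF _ y(1)]] z core_self by auto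
  then have "(z, germ z y) \<in> display_cell F \<phi> I a"
    using germ_in_cell[OF y(1) I] z(1) J(3) by simp
  then show ?thesis
    by blast
qed

text \<open>Suppose that \<open>A\<close> and \<open>B\<close> separate the cell. Each
  \<open>x\<close> has a ball over which every small cell inside the given one falls wholly on the
  side of its point at the centre. By the injective half of the cosheaf condition for this cover,
  any two such small cells are linked by a chain of overlaps. Consecutive ones share a nonempty
  cell, so the side never changes.\<close>

lemma connectedin_display_cell:
  assumes cosheaf: "cosheaf F \<phi>" and fin: "\<And>x. finite (pi0 (over f X (core \<U> x)))"
    and I: "I \<in> open_intervals"
  shows "connectedin (fst D) (display_cell F \<phi> I a)"
proof -
  let ?Z = "display_cell F \<phi> I a"
  have False if A: "openin (fst D) A" and B: "openin (fst D) B" and AB: "?Z \<subseteq> A \<union> B" "A \<inter> B \<inter> ?Z = {}"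
    and ne: "A \<inter> ?Z \<noteq> {}" "B \<inter> ?Z \<noteq> {}" for A B
  proof -
    \<comment> \<open>One radius for all \<open>y\<close>: the ball becomes a member of a cover, and
      chains of overlaps may pass through any element over it.\<close>
    define good where "good x e \<longleftrightarrow> 0 < e \<and> ball x e \<subseteq> I \<inter> core \<U> x \<and> (\<forall>y\<in>over f X (core \<U> x).
        ((x, germ x y) \<in> A \<longrightarrow> display_cell F \<phi> (ball x e) (pcomp (ball x e) y) \<subseteq> A) \<and>
        ((x, germ x y) \<in> B \<longrightarrow> display_cell F \<phi> (ball x e) (pcomp (ball x e) y) \<subseteq> B))" for x e
    have "\<exists>e. good x e" if x: "x \<in> I" for x
    proof -
      have "open (I \<inter> core \<U> x)" "x \<in> I \<inter> core \<U> x"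
        using I open_core core_self x by (auto simp: open_intervals_def)
      then obtain e0 where e0: "0 < e0" "ball x e0 \<subseteq> I \<inter> core \<U> x"
        using openE by blast
      then have "\<forall>\<^sub>F e in at_right 0. e < e0"
        by (auto simp: eventually_at_right_field)
      moreover have "\<forall>\<^sub>F e in at_right 0. 0 < (e :: real)"
        by (simp add: eventually_at_right_less)
      ultimately have "\<forall>\<^sub>F e in at_right 0. good x e"
        using uniform_small_cell[OF fin A I x] uniform_small_cell[OF fin B I x]
      proof eventually_elim
        case (elim e)
        then show ?case
          unfolding good_def using e0(2) subset_ball[of e e0 x] by fastforce
      qed
      then show ?thesis
        using eventually_happens[of _ "at_right (0::real)"] by fastforce
    qed
    then obtain e where good: "\<And>x. x \<in> I \<Longrightarrow> good x (e x)"
      by metis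
    have e: "0 < e x" "ball x (e x) \<subseteq> I \<inter> core \<U> x" if "x \<in> I" for x
      using good[OF that] unfolding good_def by - (elim conjE, assumption)+
    have eA: "display_cell F \<phi> (ball x (e x)) (pcomp (ball x (e x)) y) \<subseteq> A"
      if "x \<in> I" "y \<in> over f X (core \<U> x)" "(x, germ x y) \<in> A" for x y
      using good[OF that(1)] that(2,3) unfolding good_def by (elim conjE) (drule (1) bspec, elim conjE, erule (1) mp)
    have eB: "display_cell F \<phi> (ball x (e x)) (pcomp (ball x (e x)) y) \<subseteq> B"
      if "x \<in> I" "y \<in> over f X (core \<U> x)" "(x, germ x y) \<in> B" for x y
      using good[OF that(1)] that(2,3) unfolding good_def by (elim conjE) (drule (1) bspec, elim conjE, erule (1) mp)
    define J where "J x = ball x (e x)" for x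
    let ?\<V> = "J ` I"
    have J: "J x \<in> open_intervals" "x \<in> J x" "J x \<subseteq> I" "J x \<subseteq> core \<U> x" if "x \<in> I" for x
      using e[OF that] by (auto simp: J_def open_intervals_def)
    have \<V>: "?\<V> \<subseteq> open_intervals" "\<Union>?\<V> = I"
      using J by blast+
    have glue: "equivclp (overlap F \<phi> ?\<V>) (K, b) (K', b')"
      if "K \<in> ?\<V>" "K' \<in> ?\<V>" "b \<in> F K" "b' \<in> F K'" "\<phi> K I b = \<phi> K' I b'" for K K' b b'
      using cosheaf_cover(2)[OF cosheaf I \<V> that(1-4)] that(5) by simp
    have cellZ: "display_cell F \<phi> K b \<subseteq> ?Z" if "K \<in> ?\<V>" "\<phi> K I b = a" for K b
      using display_cell_subset[of K I F \<phi> b] that J I by auto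
    have dichotomy: "display_cell F \<phi> K b \<subseteq> A \<or> display_cell F \<phi> K b \<subseteq> B"
      if K: "K \<in> ?\<V>" and b: "b \<in> F K" and ba: "\<phi> K I b = a" for K b
    proof -
      obtain x where x: "x \<in> I" "K = J x"
        using K by blast
      obtain y where y: "y \<in> over f X (core \<U> x)" "b = pcomp K y"
        using F_small[of x K b] J[OF x(1)] x b by auto
      have "(x, germ x y) \<in> display_cell F \<phi> K b"
        using germ_in_cell[OF y(1)] J[OF x(1)] x y by auto
      then have "(x, germ x y) \<in> A \<or> (x, germ x y) \<in> B"
        using cellZ[OF K ba] AB(1) by blast
      then show ?thesis
        using eA[OF x(1) y(1)] eB[OF x(1) y(1)] by (auto simp: x(2) y(2) J_def)
    qed
    define on_A where "on_A \<equiv> \<lambda>(K, b). K \<in> ?\<V> \<and> b \<in> F K \<and> \<phi> K I b = a \<and> display_cell F \<phi> K b \<subseteq> A"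
    have on_A_step: "on_A v" if uv: "overlap F \<phi> ?\<V> u v" and u: "on_A u" for u v
      using uv u
    proof (cases rule: overlap.cases)
      case (1 K K' c)
      let ?L = "K \<inter> K'"
      have KK: "K \<in> open_intervals" "K' \<in> open_intervals" "K \<subseteq> I" "K' \<subseteq> I"
        using 1 J by auto
      then have L: "?L \<in> open_intervals"
        using open_intervals_Int 1(5) by blast
      have b': "\<phi> ?L K' c \<in> F K'" "\<phi> K' I (\<phi> ?L K' c) = a"
        using \<phi>_in_F[of c ?L K'] \<phi>_\<phi>[of c ?L K' I] \<phi>_\<phi>[of c ?L K I] KK 1 u by (auto simp: on_A_def)
      have "display_cell F \<phi> ?L c \<subseteq> display_cell F \<phi> K (\<phi> ?L K c)"
        "display_cell F \<phi> ?L c \<subseteq> display_cell F \<phi> K' (\<phi> ?L K' c)"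
        using L KK by (simp_all add: display_cell_subset)
      \<comment> \<open>A point over the overlap lies in both small cells, hence in
        \<open>A\<close>; this rules out \<open>B\<close> for the second one.\<close>
      moreover have "display_cell F \<phi> ?L c \<noteq> {}"
        using display_cell_nonempty[OF cosheaf L 1(6)] .
      moreover have "display_cell F \<phi> K (\<phi> ?L K c) \<subseteq> A"
        using u 1 by (simp add: on_A_def)
      ultimately have "\<not> display_cell F \<phi> K' (\<phi> ?L K' c) \<subseteq> B"
        using AB(2) cellZ[OF 1(4) b'(2)] by blast
      then show ?thesis
        using dichotomy[OF 1(4) b'] b' 1 by (simp add: on_A_def)
    qed
    have propagate: "on_A v" if "equivclp (overlap F \<phi> ?\<V>) u v" "on_A u" for u v
      using that
    proof (induction rule: equivclp_induct)
      case (step v w)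
      then show ?case
        using on_A_step overlap_sym by blast
    qed
    obtain x s where s: "(x, s) \<in> A \<inter> ?Z"
      using ne(1) by force
    obtain x' s' where s': "(x', s') \<in> B \<inter> ?Z"
      using ne(2) by force
    have Z: "x \<in> I" "s (J x) \<in> F (J x)" "\<phi> (J x) I (s (J x)) = a" "(x, s) \<in> display_cell F \<phi> (J x) (s (J x))"
      if "(x, s) \<in> ?Z" for x s
    proof -
      show xI: "x \<in> I"
        using that by (auto simp: display_cell_def)
      show "s (J x) \<in> F (J x)" "\<phi> (J x) I (s (J x)) = a" "(x, s) \<in> display_cell F \<phi> (J x) (s (J x))"
        using that J[OF xI] I by (auto simp: display_cell_def costalk_def)
    qed
    have "(x, s) \<in> ?Z" "(x', s') \<in> ?Z"
      using s s' by auto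
    note Z1 = Z[OF this(1)] and Z2 = Z[OF this(2)]
    have "\<not> display_cell F \<phi> (J x) (s (J x)) \<subseteq> B"
      using Z1(4) s AB(2) by blast
    then have "on_A (J x, s (J x))"
      using dichotomy[OF _ Z1(2,3)] Z1 by (auto simp: on_A_def)
    moreover have "equivclp (overlap F \<phi> ?\<V>) (J x, s (J x)) (J x', s' (J x'))"
      using glue Z1 Z2 by simp
    ultimately have "on_A (J x', s' (J x'))"
      by (rule propagate[rotated])
    then show False
      using Z2(4) s' AB(2) by (auto simp: on_A_def)
  qed
  moreover have "?Z \<subseteq> topspace (fst D)"
    using openin_subset[OF openin_display_cell[OF I]] .
  ultimately show ?thesis
    unfolding connectedin by blast
qed

end

section \<open>The interleaving\<close>

locale mapper_interleaving = mapper_space +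
  fixes \<epsilon> :: real
  assumes eps: "0 \<le> \<epsilon>"
    and diameter: "\<And>V u v. V \<in> \<U> \<Longrightarrow> V \<inter> f ` X \<noteq> {} \<Longrightarrow> u \<in> V \<Longrightarrow> v \<in> V \<Longrightarrow> \<bar>u - v\<bar> \<le> \<epsilon>"
    and cosheaf: "cosheaf (mapper_cosheaf f \<U> S T) (mapper_cosheaf_map f \<U> T)"
    and finite_pi0: "\<And>x. finite (pi0 (over f X (core \<U> x)))"
begin

abbreviation "R \<equiv> reeb_graph (top_of_set X, f)"
abbreviation "q \<equiv> reeb_class (top_of_set X, f)"

text \<open>The point \<open>y\<close> ensures that a cover member containing \<open>x\<close> meets
  the image of \<open>X\<close>; only for such members is the diameter bounded.\<close>

lemma core_diameter:
  assumes "y \<in> over f X (core \<U> x)" "u \<in> core \<U> x" "v \<in> core \<U> x"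
  shows "\<bar>u - v\<bar> \<le> \<epsilon>"
proof -
  have "x \<in> \<Union>\<U>"
    using cover by (simp add: nice_cover_def)
  then obtain V where V: "V \<in> \<U>" "x \<in> V"
    by blast
  then have "core \<U> x \<subseteq> V"
    by (auto simp: core_def)
  then show ?thesis
    using diameter[OF V(1), of u v] assms by (auto simp: subset_iff)
qed

lemma continuous_map_q: "continuous_map (top_of_set X) (fst R) q"
  using quotient_imp_continuous_map[OF quotient_map_reeb_class[of "(top_of_set X, f)"]] by simp

lemma q_in_R: "y \<in> X \<Longrightarrow> q y \<in> topspace (fst R)"
  by (simp add: topspace_reeb_graph)

lemma snd_R: "y \<in> X \<Longrightarrow> snd R (q y) = f y"
  using snd_reeb_graph[of y "(top_of_set X, f)"] by simp

text \<open>The pairs of \<open>q c\<close> and \<open>x - f c\<close> have constant level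
  \<open>f c + (x - f c) = x\<close>, and the bound on \<open>Q\<close> keeps the second coordinate
  inside the thickening.\<close>

lemma reeb_class_along:
  assumes Q: "connected Q" "Q \<subseteq> X" "\<And>c. c \<in> Q \<Longrightarrow> \<bar>x - f c\<bar> \<le> \<epsilon>" and y: "y \<in> Q" "y' \<in> Q"
  shows "reeb_class (thicken \<epsilon> R) (q y, x - f y) = reeb_class (thicken \<epsilon> R) (q y', x - f y')"
proof (rule reeb_class_eqI)
  let ?g = "\<lambda>c. (q c, x - f c)"
  have "continuous_map (top_of_set Q) (top_of_set {-\<epsilon>..\<epsilon>}) (\<lambda>c. x - f c)"
    using Q(3) by (auto simp: abs_le_iff intro!: continuous_intros continuous_on_subset[OF f] dest: Q(3))
  moreover have "continuous_map (top_of_set Q) (fst R) q"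
    using continuous_map_from_subtopology_mono[OF continuous_map_q Q(2)] .
  ultimately have "continuous_map (top_of_set Q) (fst (thicken \<epsilon> R)) ?g"
    by (simp add: thicken_def continuous_map_pairwise o_def)
  then show "connectedin (fst (thicken \<epsilon> R)) (?g ` Q)"
    by (rule connectedin_continuous_map_image) (simp add: connectedin_subtopology Q(1))
  show "?g ` Q \<subseteq> {z. snd (thicken \<epsilon> R) z = x}"
    using Q(2) by (auto simp: snd_R)
qed (use y in auto)

section \<open>From the display locale to the smoothed Reeb graph\<close>

definition alpha :: "real \<times> (real set \<Rightarrow> 'a set) \<Rightarrow> ('a set \<times> real) set" where
  "alpha u = (let y = SOME y. y \<in> over f X (core \<U> (fst u)) \<and> snd u = germ (fst u) y
     in reeb_class (thicken \<epsilon> R) (q y, fst u - f y))"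

text \<open>The representative chosen in \<open>alpha\<close> and the given \<open>y\<close> lie in
  one path component over \<open>core \<U> x\<close>, along which the Reeb class is
  constant.\<close>

lemma alpha_germ:
  assumes y: "y \<in> over f X (core \<U> x)"
  shows "alpha (x, germ x y) = reeb_class (thicken \<epsilon> R) (q y, x - f y)"
proof -
  define z where "z = (SOME z. z \<in> over f X (core \<U> x) \<and> germ x y = germ x z)"
  have z: "z \<in> over f X (core \<U> x)" "germ x y = germ x z"
    using someI[of "\<lambda>z. z \<in> over f X (core \<U> x) \<and> germ x y = germ x z" y] y unfolding z_def by blast+
  let ?Q = "path_component_set (over f X (core \<U> x)) y"
  have Q: "?Q \<subseteq> over f X (core \<U> x)"
    by (rule path_component_subset)
  have "reeb_class (thicken \<epsilon> R) (q z, x - f z) = reeb_class (thicken \<epsilon> R) (q y, x - f y)"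
  proof (rule reeb_class_along)
    show "connected ?Q"
      by (simp add: path_connected_imp_connected)
    show "\<bar>x - f c\<bar> \<le> \<epsilon>" if "c \<in> ?Q" for c
      using core_diameter[OF y core_self, of "f c"] that Q by auto
    show "z \<in> ?Q" "y \<in> ?Q"
      using germ_eq_iff[OF y z(1)] z y by (simp_all add: path_component_refl)
  qed (use Q in auto)
  then show ?thesis
    by (simp add: alpha_def z_def)
qed

lemma continuous_map_reeb_class_q:
  "continuous_map (top_of_set (X \<times> {-\<epsilon>..\<epsilon>})) (fst (smoothing \<epsilon> R)) (\<lambda>(c, t). reeb_class (thicken \<epsilon> R) (q c, t))"
proof -
  have "continuous_map (prod_topology (top_of_set X) (top_of_set {-\<epsilon>..\<epsilon>}))
      (prod_topology (fst R) (top_of_set {-\<epsilon>..\<epsilon>})) (\<lambda>(c, t). (q c, id t))"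
    by (subst continuous_map_prod_top) (auto simp: continuous_map_q)
  then have *: "continuous_map (top_of_set (X \<times> {-\<epsilon>..\<epsilon>})) (fst (thicken \<epsilon> R)) (\<lambda>(c, t). (q c, t))"
    by (simp add: thicken_def subtopology_Times[symmetric])
  have "continuous_map (fst (thicken \<epsilon> R)) (fst (smoothing \<epsilon> R)) (reeb_class (thicken \<epsilon> R))"
    using rspace_map_reeb_class[of "thicken \<epsilon> R"] by (simp add: rspace_map_def smoothing_def)
  from continuous_map_compose[OF * this] show ?thesis
    by (simp add: o_def case_prod_unfold)
qed

text \<open>A nearby value of \<open>alpha\<close> comes from a level \<open>z\<close> close to
  \<open>x\<close> and a point \<open>w\<close> anywhere in the component \<open>?C\<close>. How
  close \<open>z\<close> must be has to be uniform in \<open>w\<close>, hence the tube lemma along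
  the closure of \<open>?C\<close>. This closure is connected, so all its points give the same Reeb
  class as \<open>y\<close>, and that class is in \<open>W\<close>.\<close>

lemma openin_alpha_preimage:
  assumes W: "openin (fst (smoothing \<epsilon> R)) W"
  shows "openin (fst D) {u \<in> topspace (fst D). alpha u \<in> W}"
proof (subst openin_subopen, intro ballI)
  fix u assume "u \<in> {u \<in> topspace (fst D). alpha u \<in> W}"
  then obtain x y where u: "u = (x, germ x y)" and y: "y \<in> over f X (core \<U> x)" and uW: "alpha u \<in> W"
    unfolding topspace_D by blast
  let ?C = "path_component_set (over f X (core \<U> x)) y"
  let ?h = "\<lambda>(c, t). reeb_class (thicken \<epsilon> R) (q c, t)"
  have C: "?C \<subseteq> over f X (core \<U> x)" "y \<in> ?C"
    using path_component_subset y by (auto simp: path_component_refl)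
  have CX: "?C \<subseteq> X"
    using C(1) by auto
  have KX: "closure ?C \<subseteq> X"
    using closure_minimal[OF CX] compact compact_imp_closed by blast
  have "compact (closure ?C)"
    using compact_closure bounded_subset[OF compact_imp_bounded[OF compact] CX] by blast
  have close: "\<bar>x - f c\<bar> \<le> \<epsilon>" if "c \<in> closure ?C" for c
  proof -
    have "closed {c. \<bar>x - f c\<bar> \<le> \<epsilon>}"
      by (intro closed_Collect_le continuous_intros f)
    moreover have "?C \<subseteq> {c. \<bar>x - f c\<bar> \<le> \<epsilon>}"
      using core_diameter[OF y core_self] C(1) by auto
    ultimately show ?thesis
      using that closure_minimal by blast
  qed
  have "connected (closure ?C)"
    by (intro connected_imp_connected_closure path_connected_imp_connected) simp
  then have hW: "?h (c, x - f c) \<in> W" if "c \<in> closure ?C" for c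
    using reeb_class_along[OF _ KX close that, of y] C(2) closure_subset[of ?C] uW alpha_germ[OF y] u
    by (simp add: subset_iff)
  have "openin (top_of_set (X \<times> {-\<epsilon>..\<epsilon>})) {v \<in> X \<times> {-\<epsilon>..\<epsilon>}. ?h v \<in> W}"
    using openin_continuous_map_preimage[OF continuous_map_reeb_class_q W] by simp
  then obtain P where P: "open P" "{v \<in> X \<times> {-\<epsilon>..\<epsilon>}. ?h v \<in> W} = (X \<times> {-\<epsilon>..\<epsilon>}) \<inter> P"
    by (auto simp: openin_open)
  \<comment> \<open>The coordinates are swapped so that the compact factor comes second, as in the
    tube lemma. Continuity of \<open>f\<close> on the whole space makes \<open>P'\<close>
    open.\<close>
  define P' where "P' = (\<lambda>(t, c). (c, t - f c)) -` P"
  have "continuous_on UNIV (\<lambda>v::real \<times> 'a. (snd v, fst v - f (snd v)))"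
    by (intro continuous_intros continuous_on_compose2[OF f]) auto
  then have P': "open P'"
    unfolding P'_def using P(1) by (simp add: case_prod_unfold open_vimage)
  have sub: "{x} \<times> closure ?C \<subseteq> P'"
  proof clarify
    fix c assume c: "c \<in> closure ?C"
    then have "(c, x - f c) \<in> {v \<in> X \<times> {-\<epsilon>..\<epsilon>}. ?h v \<in> W}"
      using hW[OF c] close[OF c] KX by auto
    then show "(x, c) \<in> P'"
      using P(2) by (auto simp: P'_def)
  qed
  obtain N where N: "x \<in> N" "open N" "N \<times> closure ?C \<subseteq> P'"
    using Elementary_Topology.tube_lemma[OF \<open>compact (closure ?C)\<close> P' sub] by blast
  have "open (N \<inter> core \<U> x)" "x \<in> N \<inter> core \<U> x"
    using N open_core core_self by auto
  then obtain I where I: "I \<in> open_intervals" "x \<in> I" "I \<subseteq> N \<inter> core \<U> x"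
    using open_interval_within by blast
  let ?Z = "display_cell F \<phi> I (pcomp I y)"
  have "v \<in> topspace (fst D) \<and> alpha v \<in> W" if v: "v \<in> ?Z" for v
  proof -
    obtain z w where zw: "v = (z, germ z w)" "z \<in> I" "w \<in> over f X (core \<U> z)"
      "path_component (over f X (core \<U> x)) y w"
      using small_cell[OF I(2) _ I(1) y v] I(3) by blast
    have w: "w \<in> closure ?C" "w \<in> X" "f w \<in> core \<U> z"
      using zw(3,4) closure_subset[of ?C] by (auto simp: subset_iff)
    have "\<bar>z - f w\<bar> \<le> \<epsilon>"
      using core_diameter[OF zw(3) core_self] w by simp
    moreover have "(z, w) \<in> P'"
      using zw(2) w(1) I(3) by (intro subsetD[OF N(3)]) auto
    then have "(w, z - f w) \<in> P"
      by (simp add: P'_def)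
    ultimately have "(w, z - f w) \<in> {v \<in> X \<times> {-\<epsilon>..\<epsilon>}. ?h v \<in> W}"
      unfolding P(2) using w by auto
    then have "alpha v \<in> W"
      using alpha_germ[OF zw(3)] zw(1) by simp
    moreover have "v \<in> topspace (fst D)"
      using zw unfolding topspace_D by blast
    ultimately show ?thesis
      by simp
  qed
  moreover have "u \<in> ?Z"
    using germ_in_cell[OF y I(1)] I(2) u by simp
  ultimately show "\<exists>Z. openin (fst D) Z \<and> u \<in> Z \<and> Z \<subseteq> {u \<in> topspace (fst D). alpha u \<in> W}"
    using openin_display_cell[OF I(1)] by (intro exI[of _ ?Z]) auto
qed

lemma rspace_map_alpha: "rspace_map D (smoothing \<epsilon> R) alpha"
proof -
  have *: "(q y, x - f y) \<in> topspace (fst (thicken \<epsilon> R))" if "y \<in> over f X (core \<U> x)" for x y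
    using core_diameter[OF that core_self, of "f y"] that q_in_R by (auto simp: abs_le_iff)
  have "alpha (x, germ x y) \<in> topspace (fst (smoothing \<epsilon> R)) \<and> snd (smoothing \<epsilon> R) (alpha (x, germ x y)) = x"
    if y: "y \<in> over f X (core \<U> x)" for x y
    using snd_reeb_graph[OF *[OF y]] *[OF y] y
    by (auto simp: alpha_germ[OF y] smoothing_def topspace_reeb_graph snd_R simp del: topspace_thicken)
  moreover have "snd D = fst"
    by (simp add: display_locale_def)
  ultimately show ?thesis
    unfolding rspace_map_def continuous_map_def using openin_alpha_preimage
    by (auto simp: topspace_D Pi_iff)
qed

section \<open>From the Reeb graph to the display locale\<close>

definition beta0 :: "'a set \<Rightarrow> real \<times> (real set \<Rightarrow> 'a set)" where
  "beta0 C = (let y = SOME y. y \<in> C in (f y, germ (f y) y))"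

text \<open>A Reeb class is connected and lies in one level, hence over the open set
  \<open>core \<U> (f y)\<close>; there local path connectedness joins the chosen representative to
  \<open>y\<close>, so the germs agree.\<close>

lemma beta0_q:
  assumes "y \<in> X"
  shows "beta0 (q y) = (f y, germ (f y) y)"
proof -
  define z where "z = (SOME z. z \<in> q y)"
  have y: "y \<in> q y"
    using reeb_class_self[of y "(top_of_set X, f)"] assms by simp
  then have z: "z \<in> q y"
    unfolding z_def by (rule someI)
  have sub: "q y \<subseteq> X \<inter> {z. f z = f y}"
    using reeb_class_subset[of "(top_of_set X, f)" y] by simp
  have "connectedin (top_of_set X) (q y)"
    using connectedin_reeb_class[of "(top_of_set X, f)" y] by simp
  then have "connected (q y)"
    by (simp add: connectedin_subtopology)
  moreover have over: "q y \<subseteq> over f X (core \<U> (f y))"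
    using sub core_self[of "f y" \<U>] by (auto simp: subset_iff)
  ultimately have "path_component (over f X (core \<U> (f y))) z y"
    using z y by (intro path_component_over_connected[OF lpc f_X open_core])
  then have "germ (f y) z = germ (f y) y"
    using germ_eq_iff z y over by blast
  moreover have "f z = f y"
    using sub z by auto
  ultimately show ?thesis
    by (simp add: beta0_def z_def[symmetric])
qed

lemma rspace_map_beta0: "rspace_map R D beta0"
proof -
  have "continuous_map (top_of_set X) (fst D) (beta0 \<circ> q)"
    using continuous_map_germ by (rule continuous_map_eq) (simp add: beta0_q)
  then have "continuous_map (fst R) (fst D) beta0"
    using continuous_compose_quotient_map[OF quotient_map_reeb_class[of "(top_of_set X, f)"]] by simp
  then show ?thesis
    by (auto simp: rspace_map_def topspace_reeb_graph beta0_q snd_R display_locale_def)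
qed

text \<open>Both germs lie in the cell of \<open>y\<close> over \<open>core \<U> x\<close>. This
  cell is connected and its levels differ from \<open>x\<close> by at most
  \<open>\<epsilon>\<close>, so shifting each of its points to level \<open>x\<close> gives a
  connected set in one level of the thickening.\<close>

lemma zeta_germ_eq:
  assumes y: "y \<in> over f X (core \<U> x)"
  shows "reeb_class (thicken \<epsilon> (smoothing \<epsilon> D)) (zeta \<epsilon> D (f y, germ (f y) y), x - f y) =
    zeta \<epsilon> (smoothing \<epsilon> D) (zeta \<epsilon> D (x, germ x y))"
proof -
  let ?C = "core \<U> x"
  let ?Z = "display_cell F \<phi> ?C (pcomp ?C y)"
  let ?g = "\<lambda>v. (zeta \<epsilon> D v, x - fst v)"
  have Z: "connectedin (fst D) ?Z"
    by (rule connectedin_display_cell[OF cosheaf finite_pi0 core_interval])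
  have ZD: "?Z \<subseteq> topspace (fst D)"
    using connectedin_subset_topspace[OF Z] .
  have ZC: "fst v \<in> ?C" if "v \<in> ?Z" for v
    using that by (auto simp: display_cell_def)
  have zeta: "continuous_map (fst D) (fst (smoothing \<epsilon> D)) (zeta \<epsilon> D)"
    "\<And>v. v \<in> topspace (fst D) \<Longrightarrow> snd (smoothing \<epsilon> D) (zeta \<epsilon> D v) = fst v"
    using rspace_map_zeta[OF eps, of D] by (auto simp: rspace_map_def display_locale_def)
  have "continuous_map (subtopology (fst D) ?Z) (top_of_set {-\<epsilon>..\<epsilon>}) (\<lambda>v. x - fst v)"
  proof (rule continuous_map_into_subtopology)
    show "continuous_map (subtopology (fst D) ?Z) euclideanreal (\<lambda>v. x - fst v)"
      by (intro continuous_map_diff continuous_map_from_subtopology continuous_map_display_fst) simp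
    show "(\<lambda>v. x - fst v) \<in> topspace (subtopology (fst D) ?Z) \<rightarrow> {-\<epsilon>..\<epsilon>}"
    proof
      fix v assume "v \<in> topspace (subtopology (fst D) ?Z)"
      then have "\<bar>x - fst v\<bar> \<le> \<epsilon>"
        using core_diameter[OF y core_self ZC] by simp
      then show "x - fst v \<in> {-\<epsilon>..\<epsilon>}"
        by auto
    qed
  qed
  moreover have "continuous_map (subtopology (fst D) ?Z) (fst (smoothing \<epsilon> D)) (zeta \<epsilon> D)"
    by (rule continuous_map_from_subtopology[OF zeta(1)])
  ultimately have g: "continuous_map (subtopology (fst D) ?Z) (fst (thicken \<epsilon> (smoothing \<epsilon> D))) ?g"
    by (simp add: thicken_def continuous_map_pairwise o_def)
  have "reeb_class (thicken \<epsilon> (smoothing \<epsilon> D)) (?g (f y, germ (f y) y)) =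
      reeb_class (thicken \<epsilon> (smoothing \<epsilon> D)) (?g (x, germ x y))"
  proof (rule reeb_class_eqI)
    show "connectedin (fst (thicken \<epsilon> (smoothing \<epsilon> D))) (?g ` ?Z)"
      using g by (rule connectedin_continuous_map_image) (simp add: connectedin_subtopology Z)
    show "?g ` ?Z \<subseteq> {v. snd (thicken \<epsilon> (smoothing \<epsilon> D)) v = x}"
      using ZD zeta(2) by auto
    show "?g (f y, germ (f y) y) \<in> ?g ` ?Z"
      using germ_in_cell[OF over_core_f core_interval] y by (intro imageI) auto
    show "?g (x, germ x y) \<in> ?g ` ?Z"
      using germ_in_cell[OF y core_interval] core_self by (intro imageI) auto
  qed
  then show ?thesis
    by (simp add: zeta_def[of \<epsilon> "smoothing \<epsilon> D"])
qed

lemma interleaved: "interleaved \<epsilon> D R"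
proof -
  let ?\<beta> = "zeta \<epsilon> D \<circ> beta0"
  have \<beta>: "rspace_map R (smoothing \<epsilon> D) ?\<beta>"
    using rspace_map_compose[OF rspace_map_beta0 rspace_map_zeta[OF eps]] .
  have "smoothing_map \<epsilon> (smoothing \<epsilon> D) ?\<beta> (alpha u) = zeta \<epsilon> (smoothing \<epsilon> D) (zeta \<epsilon> D u)"
    if uD: "u \<in> topspace (fst D)" for u
  proof -
    obtain x y where u: "u = (x, germ x y)" and y: "y \<in> over f X (core \<U> x)"
      using uD unfolding topspace_D by blast
    have "\<bar>x - f y\<bar> \<le> \<epsilon>"
      using core_diameter[OF y core_self] y by simp
    then have "smoothing_map \<epsilon> (smoothing \<epsilon> D) ?\<beta> (alpha u) =
        reeb_class (thicken \<epsilon> (smoothing \<epsilon> D)) (?\<beta> (q y), x - f y)"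
      unfolding u alpha_germ[OF y] using y q_in_R by (intro smoothing_map_class[OF \<beta>]) auto
    then show ?thesis
      using zeta_germ_eq[OF y] y u by (simp add: beta0_q)
  qed
  \<comment> \<open>Here the shift is \<open>f y - f y = 0\<close>, so \<open>alpha\<close> of the
    germ at \<open>f y\<close> is already \<open>zeta\<close> of \<open>q y\<close>.\<close>
  moreover have "smoothing_map \<epsilon> (smoothing \<epsilon> R) alpha (?\<beta> Q) = zeta \<epsilon> (smoothing \<epsilon> R) (zeta \<epsilon> R Q)"
    if QR: "Q \<in> topspace (fst R)" for Q
  proof -
    obtain y where y: "y \<in> X" "Q = q y"
      using QR by (auto simp: topspace_reeb_graph)
    have "(f y, germ (f y) y) \<in> topspace (fst D)"
      using over_core_f[OF y(1)] unfolding topspace_D by blast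
    then have "smoothing_map \<epsilon> (smoothing \<epsilon> R) alpha (?\<beta> Q) =
        reeb_class (thicken \<epsilon> (smoothing \<epsilon> R)) (alpha (f y, germ (f y) y), 0)"
      using smoothing_map_class[OF rspace_map_alpha, of "(f y, germ (f y) y)" 0] eps y
      by (simp add: beta0_q zeta_def)
    then show ?thesis
      using alpha_germ[OF over_core_f[OF y(1)]] y by (simp add: zeta_def)
  qed
  ultimately show ?thesis
    unfolding interleaved_def using rspace_map_alpha \<beta> by blast
qed

lemma reeb_dist_le: "reeb_dist D R \<le> ennreal \<epsilon>"
  unfolding reeb_dist_def using interleaved eps by (intro Inf_lower) blast

end

section \<open>Events of high probability\<close>

lemma inner_prob_le_1:
  assumes "prob_space M"
  shows "inner_prob M E \<le> 1"
  unfolding inner_prob_def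
  using prob_space.prob_le_1[OF assms] by (intro cSup_least) auto

lemma measure_le_inner_prob:
  assumes "prob_space M" "A \<in> sets M" "A \<subseteq> E"
  shows "measure M A \<le> inner_prob M E"
  unfolding inner_prob_def
  by (rule cSup_upper) (use assms prob_space.prob_le_1[OF assms(1)] in \<open>auto intro!: bdd_aboveI[of _ 1]\<close>)

lemma inner_prob_approx:
  assumes M: "prob_space M" and "0 < e"
  obtains A where "A \<in> sets M" "A \<subseteq> E" "inner_prob M E - e < measure M A"
proof -
  have "{measure M A | A. A \<in> sets M \<and> A \<subseteq> E} \<noteq> {}"
    by (auto intro: exI[of _ "{}"])
  moreover have "inner_prob M E - e < Sup {measure M A | A. A \<in> sets M \<and> A \<subseteq> E}"
    using assms(2) by (simp add: inner_prob_def)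
  ultimately show thesis
    using that by (auto elim: less_cSupE)
qed

text \<open>Inclusion-exclusion for measurable sets inside \<open>E\<close> and \<open>G\<close>,
  each within \<open>e / 2\<close> of the inner probability.\<close>

lemma inner_prob_Int:
  assumes M: "prob_space M"
  shows "inner_prob M E + inner_prob M G - 1 \<le> inner_prob M (E \<inter> G)"
proof (rule field_le_epsilon)
  fix e :: real assume "0 < e"
  then have e: "0 < e / 2"
    by simp
  obtain A B where A: "A \<in> sets M" "A \<subseteq> E" "inner_prob M E - e / 2 < measure M A"
    and B: "B \<in> sets M" "B \<subseteq> G" "inner_prob M G - e / 2 < measure M B"
    using inner_prob_approx[OF M e] by metis
  interpret prob_space M by fact
  have "measure M A + measure M B - 1 \<le> measure M (A \<inter> B)"
    using finite_measure_Union'[OF A(1) B(1)] finite_measure_Diff'[OF B(1) A(1)] prob_le_1[of "A \<union> B"]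
    by (simp add: Int_commute)
  moreover have "measure M (A \<inter> B) \<le> inner_prob M (E \<inter> G)"
    using A B by (intro measure_le_inner_prob M) auto
  ultimately show "inner_prob M E + inner_prob M G - 1 \<le> inner_prob M (E \<inter> G) + e"
    using A(3) B(3) by linarith
qed

lemma whp_mono:
  assumes M: "prob_space M" and E: "whp M E" and imp: "\<And>n \<omega>. E n \<omega> \<Longrightarrow> G n \<omega>"
  shows "whp M G"
  unfolding whp_def
proof (rule tendsto_sandwich[OF _ _ E[unfolded whp_def] tendsto_const])
  have "inner_prob M {\<omega> \<in> space M. E n \<omega>} \<le> inner_prob M {\<omega> \<in> space M. G n \<omega>}" for n
  proof (rule field_le_epsilon)
    fix e :: real assume "0 < e"
    then obtain A where A: "A \<in> sets M" "A \<subseteq> {\<omega> \<in> space M. E n \<omega>}"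
      "inner_prob M {\<omega> \<in> space M. E n \<omega>} - e < measure M A"
      using inner_prob_approx[OF M] by blast
    moreover have "measure M A \<le> inner_prob M {\<omega> \<in> space M. G n \<omega>}"
      using A imp by (intro measure_le_inner_prob M) auto
    ultimately show "inner_prob M {\<omega> \<in> space M. E n \<omega>} \<le> inner_prob M {\<omega> \<in> space M. G n \<omega>} + e"
      by linarith
  qed
  then show "\<forall>\<^sub>F n in sequentially. inner_prob M {\<omega> \<in> space M. E n \<omega>} \<le> inner_prob M {\<omega> \<in> space M. G n \<omega>}"
    by simp
  show "\<forall>\<^sub>F n in sequentially. inner_prob M {\<omega> \<in> space M. G n \<omega>} \<le> 1"
    using inner_prob_le_1[OF M] by simp
qed

lemma whp_conj:
  assumes M: "prob_space M" and E: "whp M E" and G: "whp M G"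
  shows "whp M (\<lambda>n \<omega>. E n \<omega> \<and> G n \<omega>)"
proof -
  let ?E = "\<lambda>n. {\<omega> \<in> space M. E n \<omega>}" and ?G = "\<lambda>n. {\<omega> \<in> space M. G n \<omega>}"
  have "(\<lambda>n. inner_prob M (?E n) + inner_prob M (?G n) - 1) \<longlonglongrightarrow> 1 + 1 - 1"
    using E G unfolding whp_def by (intro tendsto_intros)
  then have lim: "(\<lambda>n. inner_prob M (?E n) + inner_prob M (?G n) - 1) \<longlonglongrightarrow> 1"
    by simp
  have "(\<lambda>n. inner_prob M (?E n \<inter> ?G n)) \<longlonglongrightarrow> 1"
    by (rule tendsto_sandwich[OF _ _ lim tendsto_const])
      (simp_all add: inner_prob_Int[OF M] inner_prob_le_1[OF M])
  moreover have "?E n \<inter> ?G n = {\<omega> \<in> space M. E n \<omega> \<and> G n \<omega>}" for n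
    by auto
  ultimately show ?thesis
    by (simp add: whp_def)
qed

section \<open>From homology to the Reeb distance\<close>

text \<open>The critical value is a supremum that may not be attained; the strict inequality
  provides some \<open>d\<close> above \<open>\<delta>\<close> for which the isomorphisms hold on
  the whole range up to \<open>d\<close>.\<close>

lemma H0_incl_iso_thickening:
  assumes V: "V \<in> cover_inters \<U>" and \<delta>: "0 \<le> \<delta>" "ennreal \<delta> < cover_critical_value k f X \<U>"
  shows "H0_incl_iso k (over f X V) (over f (thickening X \<delta>) V)"
proof -
  have "ennreal \<delta> < local_critical_value k f X V"
    using \<delta>(2) INF_lower[OF V] unfolding cover_critical_value_def by (rule less_le_trans)
  then obtain d where d: "0 \<le> d" "ennreal \<delta> < ennreal d"
    "\<forall>\<delta>'\<in>{0..d}. H0_incl_iso k (over f X V) (over f (thickening X \<delta>') V)"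
    unfolding local_critical_value_def less_Sup_iff by auto
  then show ?thesis
    using \<delta>(1) by (auto simp: ennreal_less_iff)
qed

lemma dist_le_resolution:
  assumes "V \<in> \<U>" "V \<inter> f ` X \<noteq> {}" "u \<in> V" "v \<in> V"
  shows "ennreal \<bar>u - v\<bar> \<le> resolution f X \<U>"
proof -
  have "ennreal \<bar>u - v\<bar> \<le> ediam V"
    unfolding ediam_def using assms(3,4) by (intro SUP_upper2[of u] SUP_upper2[of v]) (auto simp: dist_real_def)
  also have "\<dots> \<le> resolution f X \<U>"
    unfolding resolution_def using assms(1,2) by (intro SUP_upper) auto
  finally show ?thesis .
qed

text \<open>A finite resolution serves itself as the interleaving parameter; an infinite one bounds
  every distance.\<close>

lemma (in mapper_space) reeb_dist_le_resolution:
  assumes "constructible (top_of_set X, f)" "cosheaf F \<phi>"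
  shows "reeb_dist D (reeb_graph (top_of_set X, f)) \<le> resolution f X \<U>"
proof (cases "resolution f X \<U>")
  case (real \<epsilon>)
  have "mapper_interleaving X f \<U> S T \<epsilon>"
  proof
    show "\<bar>u - v\<bar> \<le> \<epsilon>" if "V \<in> \<U>" "V \<inter> f ` X \<noteq> {}" "u \<in> V" "v \<in> V" for V u v
      using dist_le_resolution[OF that] real by simp
    show "finite (pi0 (over f X (core \<U> x)))" for x
      by (rule finite_pi0_over[OF compact lpc f_X assms(1) core_interval])
  qed (use real assms in auto)
  then show ?thesis
    using mapper_interleaving.reeb_dist_le real by metis
qed simp

lemma path_component_over_mono:
  "path_component (over f A V) x y \<Longrightarrow> A \<subseteq> B \<Longrightarrow> path_component (over f B V) x y"
  by (meson over_mono order_refl path_component_of_subset)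

theorem corollary4p3:
  fixes k :: "'k::field itself"
    and X :: "'a::euclidean_space set"
    and f p :: "'a \<Rightarrow> real"
    and \<U> :: "real set set"
    and M :: "'w measure"
    and Xs :: "nat \<Rightarrow> 'w \<Rightarrow> 'a"
    and K :: "'a \<Rightarrow> real" and CK :: real
    and r :: "nat \<Rightarrow> real"
    and C :: "real \<Rightarrow> real"
    and L1 L2 \<delta>1 \<delta>2 \<epsilon>1 \<epsilon>2 :: real
  defines "Dhat \<equiv> \<lambda>n \<omega>. level_estimator K CK (r n) n (\<lambda>i. Xs i \<omega>)"
  defines "F \<equiv> \<lambda>n \<omega>. mapper_cosheaf f \<U> (Dhat n \<omega> (L1 + \<epsilon>1)) (Dhat n \<omega> (L2 - \<epsilon>2))"
    and "\<phi> \<equiv> \<lambda>n \<omega>. mapper_cosheaf_map f \<U> (Dhat n \<omega> (L2 - \<epsilon>2))"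
  assumes X: "compact X" "locally path_connected X"
    and f: "continuous_on UNIV f"
    and constructible: "constructible (top_of_set X, f)"
    and cover: "nice_cover \<U>"
    and p: "p \<in> borel_measurable borel" "\<And>x. 0 \<le> p x" "(\<integral>\<^sup>+ x. ennreal (p x) \<partial>lborel) = 1"
    and critical_pos: "0 < cover_critical_value k f X \<U>"
    and tame: "tame k f p"
    and conc: "\<exists>\<epsilon>. ennreal \<epsilon> < cover_critical_value k f X \<U> \<and> concentrated p X \<epsilon>"
    and levels: "X \<subseteq> superlevel p L1" "superlevel p L1 \<subseteq> thickening X \<delta>1"
      "thickening X \<delta>1 \<subseteq> superlevel p L2" "superlevel p L2 \<subseteq> thickening X \<delta>2"
    and deltas: "0 < \<delta>1" "\<delta>1 < \<delta>2" "ennreal \<delta>2 < cover_critical_value k f X \<U>"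
    and regular: "\<And>V. V \<in> cover_inters \<U> \<Longrightarrow> H0_regular k f p V L1"
      "\<And>V. V \<in> cover_inters \<U> \<Longrightarrow> H0_regular k f p V L2"
    and eps: "0 < \<epsilon>1" "0 < \<epsilon>2" "L2 + 2 * \<epsilon>2 < L1 - 2 * \<epsilon>1"
    and range1: "\<And>V. V \<in> cover_inters \<U> \<Longrightarrow>
        \<exists>R. regularity_range k f p V L1 R \<and> L1 - 2 * \<epsilon>1 \<in> R \<and> L1 + 2 * \<epsilon>1 \<in> R"
    and range2: "\<And>V. V \<in> cover_inters \<U> \<Longrightarrow>
        \<exists>R. regularity_range k f p V L2 R \<and> L2 - 2 * \<epsilon>2 \<in> R \<and> L2 + 2 * \<epsilon>2 \<in> R"
    and M: "prob_space M"
    and indep: "prob_space.indep_vars M (\<lambda>_. borel) Xs {1..}"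
    and density: "\<And>i. 1 \<le> i \<Longrightarrow> distributed M lborel (Xs i) (\<lambda>x. ennreal (p x))"
    and kernel: "kernel K CK"
    and C_pos: "\<And>\<epsilon>. 0 < \<epsilon> \<Longrightarrow> 0 < C \<epsilon>"
    and C_guarantee: "\<And>\<epsilon> L V. (\<epsilon>, L) \<in> {(\<epsilon>1, L1), (\<epsilon>2, L2)} \<Longrightarrow> open V \<Longrightarrow>
        (\<And>n. 1 \<le> n \<Longrightarrow> C \<epsilon> * ln (real n) \<le> real n * r n ^ DIM('a)) \<Longrightarrow>
        whp M (\<lambda>n \<omega>. level_sandwich f p (Dhat n \<omega>) \<epsilon> L V)"
    and bandwidth: "\<And>n. 0 < r n"
      "\<And>n. 1 \<le> n \<Longrightarrow> max (C \<epsilon>1) (C \<epsilon>2) * ln (real n) \<le> real n * r n ^ DIM('a)"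
    and random_cosheaf: "whp M (\<lambda>n \<omega>. cosheaf (F n \<omega>) (\<phi> n \<omega>))"
  shows "(\<lambda>n. inner_prob M {\<omega> \<in> space M.
            reeb_dist (display_locale (F n \<omega>) (\<phi> n \<omega>)) (reeb_graph (top_of_set X, f))
              \<le> resolution f X \<U>}) \<longlonglongrightarrow> 1"
proof -
  let ?E = "\<lambda>n \<omega>. (level_sandwich f p (Dhat n \<omega>) \<epsilon>1 L1 UNIV \<and> level_sandwich f p (Dhat n \<omega>) \<epsilon>2 L2 UNIV) \<and>
    cosheaf (F n \<omega>) (\<phi> n \<omega>)"
  have bandwidth': "C \<epsilon> * ln (real n) \<le> real n * r n ^ DIM('a)" if "1 \<le> n" "C \<epsilon> \<le> max (C \<epsilon>1) (C \<epsilon>2)" for \<epsilon> n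
    using bandwidth(2)[OF that(1)] mult_right_mono[OF that(2), of "ln (real n)"] that(1) by simp
  have "whp M (\<lambda>n \<omega>. level_sandwich f p (Dhat n \<omega>) \<epsilon>1 L1 UNIV)"
    "whp M (\<lambda>n \<omega>. level_sandwich f p (Dhat n \<omega>) \<epsilon>2 L2 UNIV)"
    by (rule C_guarantee; use bandwidth' in simp)+
  then have E: "whp M ?E"
    by (intro whp_conj M random_cosheaf)
  have "reeb_dist (display_locale (F n \<omega>) (\<phi> n \<omega>)) (reeb_graph (top_of_set X, f)) \<le> resolution f X \<U>"
    if "?E n \<omega>" for n \<omega>
  proof -
    let ?S = "Dhat n \<omega> (L1 + \<epsilon>1)" and ?T = "Dhat n \<omega> (L2 - \<epsilon>2)"
    have S: "superlevel p (L1 + 2 * \<epsilon>1) \<subseteq> ?S" "?S \<subseteq> superlevel p L1"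
      and T: "superlevel p L2 \<subseteq> ?T" "?T \<subseteq> superlevel p (L2 - 2 * \<epsilon>2)"
      using that by (simp_all add: level_sandwich_def over_def)
    have X\<delta>: "X \<subseteq> thickening X \<delta>1" "X \<subseteq> thickening X \<delta>2"
      using levels by auto
    have V: "core \<U> x \<in> cover_inters \<U>" for x
      by (rule core_in_cover_inters[OF cover])
    have \<delta>1: "ennreal \<delta>1 < cover_critical_value k f X \<U>"
      using deltas by (meson ennreal_leI le_less_trans less_imp_le)
    \<comment> \<open>\<open>L1\<close> is the centre of its regularity range and
      \<open>L1 + 2 * \<epsilon>1\<close> belongs to it, so these two levels can be compared;
      likewise \<open>L2\<close> and \<open>L2 - 2 * \<epsilon>2\<close>.\<close>
    have iso1: "H0_incl_iso k (over f (superlevel p (L1 + 2 * \<epsilon>1)) (core \<U> x)) (over f (superlevel p L1) (core \<U> x))" for x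
      using range1[OF V[of x]] eps(1) unfolding regularity_range_def by force
    have iso2: "H0_incl_iso k (over f (superlevel p L2) (core \<U> x)) (over f (superlevel p (L2 - 2 * \<epsilon>2)) (core \<U> x))" for x
      using range2[OF V[of x]] eps(2) unfolding regularity_range_def by force
    have iso\<delta>1: "H0_incl_iso k (over f X (core \<U> x)) (over f (thickening X \<delta>1) (core \<U> x))" for x
      using deltas by (intro H0_incl_iso_thickening[OF V _ \<delta>1]) simp
    have iso\<delta>2: "H0_incl_iso k (over f X (core \<U> x)) (over f (thickening X \<delta>2) (core \<U> x))" for x
      using deltas by (intro H0_incl_iso_thickening[OF V]) simp_all
    have mono: "superlevel p a \<subseteq> superlevel p b" if "b \<le> a" for a b
      using that by (auto simp: superlevel_def)
    interpret mapper_space X f \<U> ?S ?T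
    proof
      show "X \<subseteq> ?T" "?S \<subseteq> ?T"
        using S T levels by blast+
      fix x
      let ?V = "core \<U> x"
      \<comment> \<open>The path in \<open>?T\<close> lies in the superlevel set of
        \<open>L2 - 2 * \<epsilon>2\<close>. Regularity brings it back to \<open>L2\<close>, hence
        into the thickening by \<open>\<delta>2\<close>, and the critical value brings it back to
        \<open>X\<close>.\<close>
      show "path_component (over f X ?V) y y'"
        if y: "y \<in> over f X ?V" "y' \<in> over f X ?V" and path: "path_component (over f ?T ?V) y y'" for y y'
      proof -
        have "X \<subseteq> superlevel p L2"
          using levels by blast
        then have "y \<in> over f (superlevel p L2) ?V" "y' \<in> over f (superlevel p L2) ?V"
          using y by auto
        then have "path_component (over f (superlevel p L2) ?V) y y'"
          using eps(2) by (intro H0_incl_iso_inj[OF iso2] over_mono mono path_component_over_mono[OF path T(2)]) simp_all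
        then have "path_component (over f (thickening X \<delta>2) ?V) y y'"
          using levels(4) by (rule path_component_over_mono)
        then show ?thesis
          by (intro H0_incl_iso_inj[OF iso\<delta>2] over_mono X\<delta>(2) y order_refl)
      qed
      \<comment> \<open>\<open>?S\<close> lies in the thickening by \<open>\<delta>1\<close>, whose
        components over \<open>?V\<close> all meet \<open>X\<close>; the joining path survives in
        \<open>?T\<close>, which contains this thickening.\<close>
      show "\<exists>y\<in>over f X ?V. path_component (over f ?T ?V) y s" if s: "s \<in> over f ?S ?V" for s
      proof -
        have "s \<in> over f (thickening X \<delta>1) ?V"
          using s S(2) levels(2) by auto
        then obtain y where "y \<in> over f X ?V" "path_component (over f (thickening X \<delta>1) ?V) y s"
          using H0_incl_iso_surj[OF iso\<delta>1 over_mono[OF X\<delta>(1) order_refl]] by (metis path_component_sym)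
        moreover have "thickening X \<delta>1 \<subseteq> ?T"
          using levels(3) T(1) by (rule order_trans)
        ultimately show ?thesis
          using path_component_over_mono by blast
      qed
      \<comment> \<open>\<open>X\<close> lies in the superlevel set of \<open>L1\<close>, while
        \<open>?S\<close> is only known to contain that of \<open>L1 + 2 * \<epsilon>1\<close>.
        Regularity joins the two inside the superlevel set of \<open>L1\<close>, which is part of
        \<open>?T\<close>.\<close>
      show "\<exists>s\<in>over f ?S ?V. path_component (over f ?T ?V) s y" if y: "y \<in> over f X ?V" for y
      proof -
        have "y \<in> over f (superlevel p L1) ?V"
          using y levels(1) by auto
        moreover have "superlevel p (L1 + 2 * \<epsilon>1) \<subseteq> superlevel p L1"
          using eps(1) by (intro mono) simp
        ultimately obtain s where s: "s \<in> over f (superlevel p (L1 + 2 * \<epsilon>1)) ?V"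
          "path_component (over f (superlevel p L1) ?V) s y"
          using H0_incl_iso_surj[OF iso1 over_mono[OF _ order_refl]] by (metis path_component_sym)
        have "superlevel p L1 \<subseteq> ?T"
          using levels T(1) by blast
        then have "path_component (over f ?T ?V) s y"
          using path_component_over_mono[OF s(2)] by blast
        moreover have "s \<in> over f ?S ?V"
          using s(1) S(1) by auto
        ultimately show ?thesis
          by blast
      qed
    qed (fact X f cover)+
    have "cosheaf (mapper_cosheaf f \<U> ?S ?T) (mapper_cosheaf_map f \<U> ?T)"
      using that by (simp add: F_def \<phi>_def)
    then show ?thesis
      unfolding F_def \<phi>_def by (rule reeb_dist_le_resolution[OF constructible])
  qed
  then show ?thesis
    by (rule whp_mono[OF M E, unfolded whp_def])
qed

end
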